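(* Let $K$ be a field of characteristic $0$, let $d\geq 3$ be an integer, and let $$I(d)=(x^ay^{d-a},\,z^d : 0\leq a\leq d-1)=(y^d,xy^{d-1},x^2y^{d-2},\ldots,x^{d-1}y,z^d)\subset K[x,y,z].$$ Then $I(d)$ has at least $\frac{d}{3}$ distinct generic initial ideals; that is, the set $\{\operatorname{gin}_{\succ}(I(d)) : \succ \text{ a term order on } K[x,y,z]\}$ has at least $\frac{d}{3}$ elements.
   Context: The polynomial ring $S=K[x,y,z]$ carries the standard grading. Each $g=(g_1,\ldots,g_9)\in \operatorname{GL}_3(K)$ acts on $S$ by the $K$-algebra automorphism $x\mapsto g_1x+g_2y+g_3z$, $y\mapsto g_4x+g_5y+g_6z$, $z\mapsto g_7x+g_8y+g_9z$. For a graded ideal $I\subset S$ and a term order $\succ$ on $S$ (any term order, with no restriction on how the variables are ordered), there is a nonempty Zariski-open set $U\subset \operatorname{GL}_3(K)$ such that the initial ideal $\operatorname{in}_{\succ}(g(I))$ is the same ideal for all $g\in U$; this ideal is the generic initial ideal $\operatorname{gin}_{\succ}(I)$. The generic initial ideals of $I$ are the ideals $\operatorname{gin}_{\succ}(I)$ as $\succ$ ranges over all term orders. *)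

theory Defs
  imports
    "HOL-Library.Poly_Mapping"
    "HOL-Analysis.Determinants"
    "HOL-Computational_Algebra.Polynomial"
begin

text \<open>
  A monomial with variables in \<open>'v\<close> is its exponent vector \<open>'v \<Rightarrow>\<^sub>0 nat\<close>, written additively;
  a polynomial is a finitely supported map from monomials to coefficients, with the
  convolution product of \<open>Poly_Mapping\<close>.
\<close>

type_synonym 'v monomial = "'v \<Rightarrow>\<^sub>0 nat"

type_synonym ('v, 'k) mpoly = "'v monomial \<Rightarrow>\<^sub>0 'k"

definition Const :: "'k \<Rightarrow> ('v, 'k::zero) mpoly" where
  "Const c = Poly_Mapping.single 0 c"

definition Var :: "'v \<Rightarrow> ('v, 'k::zero_neq_one) mpoly" where
  "Var v = Poly_Mapping.single (Poly_Mapping.single v 1) 1"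

text \<open>Coefficients are mapped by \<open>\<phi>\<close>, each variable \<open>v\<close> is sent to \<open>f v\<close>.\<close>

definition eval_mpoly ::
    "('k::zero \<Rightarrow> 'r::comm_semiring_1) \<Rightarrow> ('v \<Rightarrow> 'r) \<Rightarrow> ('v, 'k) mpoly \<Rightarrow> 'r" where
  "eval_mpoly \<phi> f p =
    (\<Sum>m\<in>Poly_Mapping.keys p. \<phi> (Poly_Mapping.lookup p m) *
      (\<Prod>v\<in>Poly_Mapping.keys m. f v ^ Poly_Mapping.lookup m v))"

definition ideal_gen :: "'r::comm_ring_1 set \<Rightarrow> 'r set" where
  "ideal_gen B = module.span (*) B"

text \<open>The pair \<open>(s, t) \<in> r\<close> means that \<open>s\<close> is strictly smaller than \<open>t\<close>.\<close>

definition term_order :: "'v monomial rel \<Rightarrow> bool" where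
  "term_order r \<longleftrightarrow>
    strict_linear_order r \<and>
    (\<forall>s t u. (s, t) \<in> r \<longrightarrow> (s + u, t + u) \<in> r) \<and>
    (\<forall>t. t \<noteq> 0 \<longrightarrow> (0, t) \<in> r)"

text \<open>Only meaningful for nonzero \<open>p\<close>.\<close>

definition initial_monomial :: "'v monomial rel \<Rightarrow> ('v, 'k::zero) mpoly \<Rightarrow> 'v monomial" where
  "initial_monomial r p =
    (THE m. m \<in> Poly_Mapping.keys p \<and> (\<forall>m'\<in>Poly_Mapping.keys p. m' \<noteq> m \<longrightarrow> (m', m) \<in> r))"

definition initial_ideal ::
    "'v monomial rel \<Rightarrow> ('v, 'k::comm_ring_1) mpoly set \<Rightarrow> ('v, 'k) mpoly set" where
  "initial_ideal r I =
    ideal_gen ((\<lambda>p. Poly_Mapping.single (initial_monomial r p) 1) ` (I - {0}))"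

text \<open>The algebra automorphism sending the \<open>i\<close>-th variable to the linear form given by row \<open>i\<close>.\<close>

definition matrix_act :: "'k::comm_ring_1^3^3 \<Rightarrow> (3, 'k) mpoly \<Rightarrow> (3, 'k) mpoly" where
  "matrix_act g = eval_mpoly Const (\<lambda>i. \<Sum>j\<in>UNIV. Const (g $ i $ j) * Var j)"

text \<open>
  The closed subsets of \<open>GL\<^sub>3\<close> are the zero loci in \<open>GL\<^sub>3\<close> of sets of polynomials in the
  nine matrix entries: inverting the determinant in the coordinate ring yields no further
  zero loci.
\<close>

definition zariski_open_GL3 :: "('k::field^3^3) set \<Rightarrow> bool" where
  "zariski_open_GL3 U \<longleftrightarrow>
    (\<exists>P :: (3 \<times> 3, 'k) mpoly set.
      U = {g. invertible g \<and> (\<exists>p\<in>P. eval_mpoly (\<lambda>c. c) (\<lambda>(i, j). g $ i $ j) p \<noteq> 0)})"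

definition is_gin ::
    "3 monomial rel \<Rightarrow> (3, 'k::field) mpoly set \<Rightarrow> (3, 'k) mpoly set \<Rightarrow> bool" where
  "is_gin r I J \<longleftrightarrow>
    (\<exists>U. zariski_open_GL3 U \<and> U \<noteq> {} \<and> (\<forall>g\<in>U. initial_ideal r (matrix_act g ` I) = J))"

definition generic_initial_ideals :: "(3, 'k::field) mpoly set \<Rightarrow> (3, 'k) mpoly set set" where
  "generic_initial_ideals I = {J. \<exists>r. term_order r \<and> is_gin r I J}"

text \<open>The variables \<open>x\<close>, \<open>y\<close>, \<open>z\<close> are \<open>Var 1\<close>, \<open>Var 2\<close>, \<open>Var 3\<close>.\<close>

definition I_ideal :: "nat \<Rightarrow> (3, 'k::field) mpoly set" where
  "I_ideal d = ideal_gen ({Var 1 ^ a * Var 2 ^ (d - a) | a. a \<le> d - 1} \<union> {Var 3 ^ d})"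

text \<open>
  Over an infinite field two nonempty open subsets of \<open>GL\<^sub>3\<close> meet, so each term order
  contributes at most one element to \<open>generic_initial_ideals\<close>.
\<close>

lemma zariski_open_GL3_Int_nonempty:
  fixes U V :: "('k::field_char_0^3^3) set"
  assumes "zariski_open_GL3 U" "U \<noteq> {}" "zariski_open_GL3 V" "V \<noteq> {}"
  shows "U \<inter> V \<noteq> {}"
proof -
  let ?e = "\<lambda>(g :: 'k^3^3) (p :: (3 \<times> 3, 'k) mpoly). eval_mpoly (\<lambda>c. c) (\<lambda>(i, j). g $ i $ j) p"
  obtain P where P: "U = {g. invertible g \<and> (\<exists>p\<in>P. ?e g p \<noteq> 0)}"
    using assms(1) unfolding zariski_open_GL3_def by blast
  obtain Q where Q: "V = {g. invertible g \<and> (\<exists>p\<in>Q. ?e g p \<noteq> 0)}"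
    using assms(3) unfolding zariski_open_GL3_def by blast
  obtain A p where A: "invertible A" "p \<in> P" "?e A p \<noteq> 0"
    using assms(2) P by blast
  obtain B q where B: "invertible B" "q \<in> Q" "?e B q \<noteq> 0"
    using assms(4) Q by blast
  define L :: "'k poly^3^3" where "L = (\<chi> i j. [:A $ i $ j, B $ i $ j - A $ i $ j:])"
  define M where "M t = (\<chi> i j. poly (L $ i $ j) t)" for t
  define E where "E p = eval_mpoly (\<lambda>c. [:c:]) (\<lambda>(i, j). L $ i $ j) p"
    for p :: "(3 \<times> 3, 'k) mpoly"
  have E: "poly (E p) t = ?e (M t) p" for p t
    unfolding E_def eval_mpoly_def M_def
    by (simp add: poly_sum poly_prod poly_mult poly_power case_prod_unfold)
  have D: "poly (det L) t = det (M t)" for t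
    by (simp add: det_3 M_def)
  have M0: "M 0 = A" and M1: "M 1 = B"
    by (simp_all add: M_def L_def vec_eq_iff)
  have "E p \<noteq> 0" using E[of p 0] A M0 by auto
  moreover have "E q \<noteq> 0" using E[of q 1] B M1 by auto
  moreover have "det L \<noteq> 0" using D[of 0] A M0 invertible_det_nz[of A] by auto
  ultimately have "E p * E q * det L \<noteq> 0" by simp
  then have "finite {t. poly (E p * E q * det L) t = 0}"
    by (rule poly_roots_finite)
  then obtain t where "poly (E p * E q * det L) t \<noteq> 0"
    using infinite_UNIV_char_0[where 'a = 'k] by (metis (mono_tags, lifting) UNIV_eq_I mem_Collect_eq)
  then have "?e (M t) p \<noteq> 0" "?e (M t) q \<noteq> 0" "invertible (M t)"
    by (simp_all add: E D invertible_det_nz)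
  then show ?thesis using P Q A(2) B(2) by blast
qed

lemma is_gin_unique:
  fixes I :: "(3, 'k::field_char_0) mpoly set"
  assumes "is_gin r I J" "is_gin r I J'"
  shows "J = J'"
proof -
  obtain U where U: "zariski_open_GL3 U" "U \<noteq> {}"
      "\<And>g. g \<in> U \<Longrightarrow> initial_ideal r (matrix_act g ` I) = J"
    using assms(1) unfolding is_gin_def by blast
  obtain V where V: "zariski_open_GL3 V" "V \<noteq> {}"
      "\<And>g. g \<in> V \<Longrightarrow> initial_ideal r (matrix_act g ` I) = J'"
    using assms(2) unfolding is_gin_def by blast
  show ?thesis
    using zariski_open_GL3_Int_nonempty[OF U(1,2) V(1,2)] U(3) V(3) by blast
qed

end

theory Submission
  imports Defs
begin

text \<open>
  On the dense open set where two entries and two minors do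
  not vanish, a matrix factors as \<open>s ** h ** b\<close>, where \<open>s\<close> stabilises \<open>I(d)\<close>, \<open>h\<close> is a fixed matrix and
  \<open>b\<close> is upper triangular. For every term order with \<open>x > y > z\<close> the factor \<open>b\<close> does not change initial
  monomials, so the generic initial ideal is the initial ideal of the single ideal
  \<open>h(I(d)) = x(x, y)\<^sup>d\<^sup>-\<^sup>1 + (L\<^sup>d)\<close> with \<open>L = x + y + z\<close>.

  For \<open>1 \<le> e \<le> d/2\<close> order monomials by the weight \<open>(m + 1, m, 0)\<close> with \<open>m = d - 1 - e\<close>, breaking ties by the
  exponent of \<open>y\<close>. Then \<open>y\<^sup>dz\<^sup>k\<close> with \<open>k < e\<close> is not an initial monomial: an element \<open>A + L\<^sup>d B\<close> with
  this initial monomial has \<open>B(0, y, z) = c z\<^sup>k\<close>, and the coefficient of \<open>z\<^sup>k\<^sup>+\<^sup>1\<close> in \<open>L\<^sup>d B\<close> has the form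
  \<open>(x + y)\<^sup>d\<^sup>-\<^sup>1\<^sup>-\<^sup>k Q\<close> and \<open>x\<close>-degree at most \<open>m < d - 1 - k\<close>, so \<open>Q = 0\<close>, although
  \<open>Q(0, y) = d c y\<^sup>k\<close>. On the other hand \<open>y\<^sup>dz\<^sup>e\<close> is an initial monomial, since
  \<open>B = z\<^sup>e + \<kappa> (y\<^sup>e - (x + y)\<^sup>e)\<close> with \<open>\<kappa> = d / (d choose (e + 1))\<close> makes \<open>Q\<close> equal to \<open>d y\<^sup>e\<close>. So the
  \<open>d div 2\<close> orders give pairwise distinct generic initial ideals.
\<close>

section \<open>Evaluation homomorphisms and ideals\<close>

text \<open>The zero law is listed because it does not follow from additivity in a semiring.\<close>

definition is_ring_hom :: "('a::comm_semiring_1 \<Rightarrow> 'b::comm_semiring_1) \<Rightarrow> bool" where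
  "is_ring_hom \<phi> \<longleftrightarrow> \<phi> 0 = 0 \<and> \<phi> 1 = 1 \<and> (\<forall>a b. \<phi> (a + b) = \<phi> a + \<phi> b) \<and> (\<forall>a b. \<phi> (a * b) = \<phi> a * \<phi> b)"

lemma is_ring_hom_0: "is_ring_hom \<phi> \<Longrightarrow> \<phi> 0 = 0"
  and is_ring_hom_1: "is_ring_hom \<phi> \<Longrightarrow> \<phi> 1 = 1"
  and is_ring_hom_add: "is_ring_hom \<phi> \<Longrightarrow> \<phi> (a + b) = \<phi> a + \<phi> b"
  and is_ring_hom_mult: "is_ring_hom \<phi> \<Longrightarrow> \<phi> (a * b) = \<phi> a * \<phi> b"
  by (simp_all add: is_ring_hom_def)

lemma is_ring_hom_power: "is_ring_hom \<phi> \<Longrightarrow> \<phi> (a ^ n) = \<phi> a ^ n"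
  by (induction n) (simp_all add: is_ring_hom_1 is_ring_hom_mult)

lemma is_ring_hom_sum: "is_ring_hom \<phi> \<Longrightarrow> \<phi> (sum f A) = (\<Sum>a\<in>A. \<phi> (f a))"
  by (induction A rule: infinite_finite_induct) (simp_all add: is_ring_hom_0 is_ring_hom_add)

lemma is_ring_hom_prod: "is_ring_hom \<phi> \<Longrightarrow> \<phi> (prod f A) = (\<Prod>a\<in>A. \<phi> (f a))"
  by (induction A rule: infinite_finite_induct) (simp_all add: is_ring_hom_1 is_ring_hom_mult)

lemma is_ring_hom_diff:
  fixes \<phi> :: "'a::comm_ring_1 \<Rightarrow> 'b::comm_ring_1"
  assumes "is_ring_hom \<phi>"
  shows "\<phi> (a - b) = \<phi> a - \<phi> b"
  using is_ring_hom_add[OF assms, of "a - b" b] by simp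

lemmas is_ring_hom_simps = is_ring_hom_0 is_ring_hom_1 is_ring_hom_add is_ring_hom_mult
  is_ring_hom_power is_ring_hom_sum is_ring_hom_prod

lemma is_ring_hom_comp: "is_ring_hom \<phi> \<Longrightarrow> is_ring_hom \<psi> \<Longrightarrow> is_ring_hom (\<lambda>a. \<psi> (\<phi> a))"
  by (simp add: is_ring_hom_def)

lemma poly_mapping_sum_singles:
  "(\<Sum>m\<in>Poly_Mapping.keys p. Poly_Mapping.single m (Poly_Mapping.lookup p m)) = p"
  by (rule poly_mapping_eqI) (auto simp: lookup_sum lookup_single when_def in_keys_iff)

lemma keys_sum_UN: "Poly_Mapping.keys (sum f A) \<subseteq> (\<Union>a\<in>A. Poly_Mapping.keys (f a))"
proof
  fix k assume "k \<in> Poly_Mapping.keys (sum f A)"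
  then have "(\<Sum>a\<in>A. Poly_Mapping.lookup (f a) k) \<noteq> 0" by (simp add: in_keys_iff lookup_sum)
  then obtain a where "a \<in> A" "Poly_Mapping.lookup (f a) k \<noteq> 0" by (meson sum.neutral)
  then show "k \<in> (\<Union>a\<in>A. Poly_Mapping.keys (f a))" by (auto simp: in_keys_iff)
qed

lemma is_ring_hom_Const: "is_ring_hom Const"
  by (simp add: is_ring_hom_def Const_def single_add mult_single)

lemma Var_power_single: "Var v ^ n = Poly_Mapping.single (Poly_Mapping.single v n) (1::'k::comm_semiring_1)"
  by (induction n) (simp_all add: Var_def mult_single flip: single_add)

lemma monomial_conv_prod:
  assumes "finite A"
  shows "(\<Prod>v\<in>A. Var v ^ e v) = (Poly_Mapping.single (\<Sum>v\<in>A. Poly_Mapping.single v (e v)) 1 ::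
    ('v, 'k::comm_semiring_1) mpoly)"
  using assms by (induction A rule: finite_induct) (simp_all add: Var_power_single mult_single)

lemma single_conv_prod:
  "Poly_Mapping.single m c = Const c * (\<Prod>v\<in>Poly_Mapping.keys m. Var v ^ Poly_Mapping.lookup m v)"
  for c :: "'k::comm_semiring_1"
  by (simp add: monomial_conv_prod poly_mapping_sum_singles Const_def mult_single)

text \<open>Absent monomials contribute \<open>\<phi> 0 = 0\<close>, so two polynomials can be
  evaluated over one common index set; additivity rests on this.\<close>

lemma eval_mpoly_superset:
  assumes "\<phi> 0 = 0" "finite S" "Poly_Mapping.keys p \<subseteq> S"
  shows "eval_mpoly \<phi> f p = (\<Sum>m\<in>S. \<phi> (Poly_Mapping.lookup p m) *
    (\<Prod>v\<in>Poly_Mapping.keys m. f v ^ Poly_Mapping.lookup m v))"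
  unfolding eval_mpoly_def using assms
  by (intro sum.mono_neutral_left) (auto simp: in_keys_iff)

lemma eval_mpoly_single:
  assumes "\<phi> 0 = 0"
  shows "eval_mpoly \<phi> f (Poly_Mapping.single m c) =
    \<phi> c * (\<Prod>v\<in>Poly_Mapping.keys m. f v ^ Poly_Mapping.lookup m v)"
  using eval_mpoly_superset[of \<phi> "{m}" "Poly_Mapping.single m c" f] assms by simp

lemma eval_mpoly_add:
  assumes "is_ring_hom \<phi>"
  shows "eval_mpoly \<phi> f (p + q) = eval_mpoly \<phi> f p + eval_mpoly \<phi> f q"
proof -
  let ?S = "Poly_Mapping.keys p \<union> Poly_Mapping.keys q"
  have "eval_mpoly \<phi> f r = (\<Sum>m\<in>?S. \<phi> (Poly_Mapping.lookup r m) *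
      (\<Prod>v\<in>Poly_Mapping.keys m. f v ^ Poly_Mapping.lookup m v))"
    if "Poly_Mapping.keys r \<subseteq> ?S" for r
    using that assms by (intro eval_mpoly_superset) (auto simp: is_ring_hom_0)
  then show ?thesis
    using assms keys_add[of p q]
    by (simp add: lookup_add is_ring_hom_add distrib_right sum.distrib)
qed

lemma prod_power_keys_add:
  fixes m n :: "'v \<Rightarrow>\<^sub>0 nat"
  shows "(\<Prod>v\<in>Poly_Mapping.keys (m + n). f v ^ Poly_Mapping.lookup (m + n) v) =
    (\<Prod>v\<in>Poly_Mapping.keys m. f v ^ Poly_Mapping.lookup m v) *
    (\<Prod>v\<in>Poly_Mapping.keys n. f v ^ Poly_Mapping.lookup n v :: 'r::comm_semiring_1)"
proof -
  let ?S = "Poly_Mapping.keys m \<union> Poly_Mapping.keys n"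
  have *: "(\<Prod>v\<in>Poly_Mapping.keys k. f v ^ Poly_Mapping.lookup k v) =
      (\<Prod>v\<in>?S. f v ^ Poly_Mapping.lookup k v)" if "Poly_Mapping.keys k \<subseteq> ?S" for k :: "'v \<Rightarrow>\<^sub>0 nat"
    using that by (intro prod.mono_neutral_left) (auto simp: in_keys_iff)
  show ?thesis
    unfolding *[OF keys_add] *[OF Un_upper1] *[OF Un_upper2]
    by (simp add: lookup_add power_add prod.distrib)
qed

lemma is_ring_hom_eval_mpoly:
  assumes "is_ring_hom \<phi>"
  shows "is_ring_hom (eval_mpoly \<phi> f)"
proof -
  note \<phi> = is_ring_hom_simps[OF assms]
  have 0: "eval_mpoly \<phi> f 0 = 0" by (simp add: eval_mpoly_def)
  note add = eval_mpoly_add[OF assms, of f]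
  have sum: "eval_mpoly \<phi> f (sum g A) = (\<Sum>a\<in>A. eval_mpoly \<phi> f (g a))" for A and g :: "'z \<Rightarrow> _"
    by (induction A rule: infinite_finite_induct) (simp_all add: 0 add)
  let ?s = "\<lambda>p m. Poly_Mapping.single m (Poly_Mapping.lookup p m)"
  have "eval_mpoly \<phi> f (p * q) = eval_mpoly \<phi> f p * eval_mpoly \<phi> f q" for p q
  proof -
    have "p * q = (\<Sum>m\<in>Poly_Mapping.keys p. ?s p m) * (\<Sum>n\<in>Poly_Mapping.keys q. ?s q n)"
      by (simp only: poly_mapping_sum_singles)
    also have "eval_mpoly \<phi> f \<dots> = (\<Sum>m\<in>Poly_Mapping.keys p. \<Sum>n\<in>Poly_Mapping.keys q.
        eval_mpoly \<phi> f (?s p m) * eval_mpoly \<phi> f (?s q n))"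
      by (simp add: sum_product sum mult_single eval_mpoly_single \<phi> prod_power_keys_add mult_ac)
    also have "\<dots> = eval_mpoly \<phi> f (\<Sum>m\<in>Poly_Mapping.keys p. ?s p m) *
        eval_mpoly \<phi> f (\<Sum>n\<in>Poly_Mapping.keys q. ?s q n)"
      by (simp add: sum_product sum)
    finally show ?thesis by (simp only: poly_mapping_sum_singles)
  qed
  moreover have "eval_mpoly \<phi> f 1 = 1"
    using eval_mpoly_single[of \<phi> f 0 1] \<phi> by simp
  ultimately show ?thesis by (simp add: is_ring_hom_def 0 add)
qed

lemma eval_mpoly_Const: "is_ring_hom \<phi> \<Longrightarrow> eval_mpoly \<phi> f (Const c) = \<phi> c"
  by (simp add: Const_def eval_mpoly_single is_ring_hom_0)

lemma eval_mpoly_Var: "is_ring_hom \<phi> \<Longrightarrow> eval_mpoly \<phi> f (Var v) = f v"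
  by (simp add: Var_def eval_mpoly_single is_ring_hom_0 is_ring_hom_1)

text \<open>Every monomial is a constant times powers of variables, so the values on constants and
  variables determine a homomorphism.\<close>

lemma is_ring_hom_eqI:
  fixes F G :: "('v, 'k::comm_semiring_1) mpoly \<Rightarrow> 'r::comm_semiring_1"
  assumes "is_ring_hom F" "is_ring_hom G"
    and "\<And>c. F (Const c) = G (Const c)" "\<And>v. F (Var v) = G (Var v)"
  shows "F p = G p"
proof -
  have "F (Poly_Mapping.single m c) = G (Poly_Mapping.single m c)" for m c
    by (simp add: single_conv_prod is_ring_hom_simps[OF assms(1)] is_ring_hom_simps[OF assms(2)] assms(3,4))
  then have "F (\<Sum>m\<in>Poly_Mapping.keys p. Poly_Mapping.single m (Poly_Mapping.lookup p m)) =
      G (\<Sum>m\<in>Poly_Mapping.keys p. Poly_Mapping.single m (Poly_Mapping.lookup p m))"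
    by (simp add: is_ring_hom_sum[OF assms(1)] is_ring_hom_sum[OF assms(2)])
  then show ?thesis by (simp only: poly_mapping_sum_singles)
qed

section \<open>Ideals and their images\<close>

interpretation ring_module: module "(*) :: 'r::comm_ring_1 \<Rightarrow> 'r \<Rightarrow> 'r"
  by unfold_locales (simp_all add: algebra_simps)

lemma ideal_gen_superset: "B \<subseteq> ideal_gen B"
  and ideal_gen_0: "0 \<in> ideal_gen B"
  and ideal_gen_add: "p \<in> ideal_gen B \<Longrightarrow> q \<in> ideal_gen B \<Longrightarrow> p + q \<in> ideal_gen B"
  and ideal_gen_diff: "p \<in> ideal_gen B \<Longrightarrow> q \<in> ideal_gen B \<Longrightarrow> p - q \<in> ideal_gen B"
  and ideal_gen_mult: "p \<in> ideal_gen B \<Longrightarrow> c * p \<in> ideal_gen B"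
  and ideal_gen_sum: "(\<And>a. a \<in> A \<Longrightarrow> f a \<in> ideal_gen B) \<Longrightarrow> sum f A \<in> ideal_gen B"
  unfolding ideal_gen_def
  by (auto simp: ring_module.span_base ring_module.span_zero ring_module.span_add ring_module.span_diff
      ring_module.span_scale ring_module.span_sum)

lemma ideal_gen_induct [consumes 1, case_names base step]:
  assumes "p \<in> ideal_gen B" "P 0" "\<And>c b q. b \<in> B \<Longrightarrow> P q \<Longrightarrow> P (c * b + q)"
  shows "P p"
  using assms ring_module.span_induct_alt unfolding ideal_gen_def by blast

lemma ideal_gen_subsetI:
  assumes "B \<subseteq> ideal_gen C"
  shows "ideal_gen B \<subseteq> ideal_gen C"
proof
  fix p assume "p \<in> ideal_gen B"
  then show "p \<in> ideal_gen C"
    using assms by (induction rule: ideal_gen_induct) (auto intro: ideal_gen_0 ideal_gen_add ideal_gen_mult)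
qed

text \<open>Surjectivity makes the image absorb multiplication by every element of the target
  ring.\<close>

lemma ideal_gen_image:
  fixes \<phi> :: "'r::comm_ring_1 \<Rightarrow> 's::comm_ring_1"
  assumes "is_ring_hom \<phi>" "surj \<phi>"
  shows "\<phi> ` ideal_gen B = ideal_gen (\<phi> ` B)"
proof
  note hom = is_ring_hom_simps[OF assms(1)]
  show "\<phi> ` ideal_gen B \<subseteq> ideal_gen (\<phi> ` B)"
  proof
    fix q assume "q \<in> \<phi> ` ideal_gen B"
    then obtain p where p: "p \<in> ideal_gen B" "q = \<phi> p" by blast
    from p(1) have "\<phi> p \<in> ideal_gen (\<phi> ` B)"
    proof (induction rule: ideal_gen_induct)
      case (step c b q)
      then show ?case
        using ideal_gen_superset[of "\<phi> ` B"] by (auto simp: hom intro!: ideal_gen_add ideal_gen_mult)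
    qed (simp add: hom ideal_gen_0)
    then show "q \<in> ideal_gen (\<phi> ` B)" using p by simp
  qed
  show "ideal_gen (\<phi> ` B) \<subseteq> \<phi> ` ideal_gen B"
  proof
    fix q assume "q \<in> ideal_gen (\<phi> ` B)"
    then show "q \<in> \<phi> ` ideal_gen B"
    proof (induction rule: ideal_gen_induct)
      case base
      show ?case using hom(1) ideal_gen_0 by (metis imageI)
    next
      case (step c b q)
      then obtain p b' where "p \<in> ideal_gen B" "q = \<phi> p" "b' \<in> B" "b = \<phi> b'" by blast
      moreover obtain c' where "c = \<phi> c'" using assms(2) by blast
      ultimately have "c * b + q = \<phi> (c' * b' + p)" "c' * b' + p \<in> ideal_gen B"
        using ideal_gen_superset[of B] by (auto simp: hom intro!: ideal_gen_add ideal_gen_mult)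
      then show ?case by blast
    qed
  qed
qed

section \<open>Linear substitutions as a matrix action\<close>

lemma is_ring_hom_matrix_act: "is_ring_hom (matrix_act g)"
  unfolding matrix_act_def by (intro is_ring_hom_eval_mpoly is_ring_hom_Const)

lemma matrix_act_Const: "matrix_act g (Const c) = Const c"
  and matrix_act_Var: "matrix_act g (Var i) = (\<Sum>j\<in>UNIV. Const (g $ i $ j) * Var j)"
  by (simp_all add: matrix_act_def eval_mpoly_Const eval_mpoly_Var is_ring_hom_Const)

lemmas matrix_act_simps = is_ring_hom_simps[OF is_ring_hom_matrix_act] matrix_act_Const matrix_act_Var

text \<open>Substituting the forms of \<open>b\<close> into row \<open>i\<close> of \<open>h\<close>
  yields row \<open>i\<close> of \<open>h ** b\<close>. The left factor of a matrix product is thus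
  the substitution carried out first.\<close>

lemma matrix_act_comp: "matrix_act b (matrix_act h p) = matrix_act (h ** b) p"
proof (rule is_ring_hom_eqI[where F = "\<lambda>p. matrix_act b (matrix_act h p)"])
  fix i
  have "matrix_act b (matrix_act h (Var i)) =
      (\<Sum>j\<in>UNIV. \<Sum>k\<in>UNIV. Const (h $ i $ j) * (Const (b $ j $ k) * Var k))"
    by (simp add: matrix_act_simps sum_distrib_left)
  also have "\<dots> = (\<Sum>k\<in>UNIV. \<Sum>j\<in>UNIV. Const (h $ i $ j) * (Const (b $ j $ k) * Var k))"
    by (rule sum.swap)
  also have "\<dots> = (\<Sum>k\<in>UNIV. Const (\<Sum>j\<in>UNIV. h $ i $ j * b $ j $ k) * Var k)"
    by (simp only: is_ring_hom_sum[OF is_ring_hom_Const] is_ring_hom_mult[OF is_ring_hom_Const]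
        sum_distrib_right mult.assoc)
  also have "\<dots> = matrix_act (h ** b) (Var i)"
    by (simp add: matrix_act_Var matrix_matrix_mult_def)
  finally show "matrix_act b (matrix_act h (Var i)) = matrix_act (h ** b) (Var i)" .
qed (auto intro: is_ring_hom_comp is_ring_hom_matrix_act simp: matrix_act_Const)

lemma matrix_act_mat_1: "matrix_act (mat 1) p = p"
proof (rule is_ring_hom_eqI[where G = "\<lambda>p. p"])
  fix i :: 3
  show "matrix_act (mat 1) (Var i) = (Var i :: (3, 'a) mpoly)"
    unfolding matrix_act_Var mat_def
    by (simp add: is_ring_hom_simps[OF is_ring_hom_Const] if_distrib[of Const] if_distrib[of "\<lambda>c. c * _"] cong: if_cong)
qed (auto intro: is_ring_hom_matrix_act simp: matrix_act_Const is_ring_hom_def[of "\<lambda>p. p"])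

lemma surj_matrix_act:
  assumes "invertible g"
  shows "surj (matrix_act g)"
proof -
  obtain h where "h ** g = mat 1" using assms unfolding invertible_def by blast
  then have "matrix_act g (matrix_act h p) = p" for p
    by (simp add: matrix_act_comp matrix_act_mat_1)
  then show ?thesis by (rule surjI)
qed

lemma matrix_act_ideal_gen:
  "invertible g \<Longrightarrow> matrix_act g ` ideal_gen B = ideal_gen (matrix_act g ` B)"
  by (intro ideal_gen_image is_ring_hom_matrix_act surj_matrix_act)

section \<open>Leading monomials\<close>

text \<open>The value \<open>c = 0\<close> is allowed, so that leads multiply over any commutative
  ring; \<open>c \<noteq> 0\<close> is demanded separately where \<open>m\<close> has to be the
  initial monomial.\<close>

definition has_lead :: "'v monomial rel \<Rightarrow> 'v monomial \<Rightarrow> 'k \<Rightarrow> ('v, 'k::zero) mpoly \<Rightarrow> bool" where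
  "has_lead r m c p \<longleftrightarrow>
    Poly_Mapping.lookup p m = c \<and> (\<forall>k\<in>Poly_Mapping.keys p. k = m \<or> (k, m) \<in> r)"

lemma term_order_trans: "term_order r \<Longrightarrow> (s, t) \<in> r \<Longrightarrow> (t, u) \<in> r \<Longrightarrow> (s, u) \<in> r"
  unfolding term_order_def strict_linear_order_on_def by (blast dest: transD)

lemma term_order_irrefl: "term_order r \<Longrightarrow> (s, s) \<notin> r"
  unfolding term_order_def strict_linear_order_on_def by (blast dest: irreflD)

lemma term_order_total: "term_order r \<Longrightarrow> s \<noteq> t \<Longrightarrow> (s, t) \<in> r \<or> (t, s) \<in> r"
  unfolding term_order_def strict_linear_order_on_def total_on_def by blast

lemma term_order_add: "term_order r \<Longrightarrow> (s, t) \<in> r \<Longrightarrow> (s + u, t + u) \<in> r"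
  unfolding term_order_def by blast

lemma term_order_add_strict:
  assumes "term_order r" "(s, t) \<in> r" "u = v \<or> (u, v) \<in> r"
  shows "(s + u, t + v) \<in> r"
proof -
  have "(s + u, t + u) \<in> r" using assms term_order_add by blast
  moreover have "t + u = t + v \<or> (t + u, t + v) \<in> r"
    using assms(3) term_order_add[OF assms(1), of u v t] by (auto simp: add.commute)
  ultimately show ?thesis using term_order_trans[OF assms(1)] by auto
qed

lemma has_lead_single: "has_lead r m c (Poly_Mapping.single m c)"
  by (simp add: has_lead_def)

text \<open>Once both leading terms are split off, all remaining products of monomials lie strictly
  below \<open>m + n\<close>.\<close>

lemma has_lead_mult:
  fixes p q :: "('v, 'k::comm_ring_1) mpoly"
  assumes r: "term_order r" and p: "has_lead r m c p" and q: "has_lead r n e q"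
  shows "has_lead r (m + n) (c * e) (p * q)"
proof -
  define p' q' where "p' = p - Poly_Mapping.single m c" and "q' = q - Poly_Mapping.single n e"
  have p': "(k, m) \<in> r" if "k \<in> Poly_Mapping.keys p'" for k
    using that p by (auto simp: p'_def has_lead_def in_keys_iff lookup_minus lookup_single when_def split: if_splits)
  have q': "(k, n) \<in> r" if "k \<in> Poly_Mapping.keys q'" for k
    using that q by (auto simp: q'_def has_lead_def in_keys_iff lookup_minus lookup_single when_def split: if_splits)
  define s where "s = p' * q + Poly_Mapping.single m c * q'"
  have pq: "p * q = Poly_Mapping.single (m + n) (c * e) + s"
    by (simp add: s_def p'_def q'_def algebra_simps mult_single)
  have s: "(k, m + n) \<in> r" if "k \<in> Poly_Mapping.keys s" for k
  proof -
    have "k \<in> Poly_Mapping.keys (p' * q) \<or> k \<in> Poly_Mapping.keys (Poly_Mapping.single m c * q')"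
      using that keys_add[of "p' * q"] unfolding s_def by blast
    then show ?thesis
    proof
      assume "k \<in> Poly_Mapping.keys (p' * q)"
      then obtain a b where "k = a + b" "a \<in> Poly_Mapping.keys p'" "b \<in> Poly_Mapping.keys q"
        using keys_mult by blast
      then show ?thesis using term_order_add_strict[OF r, of a m b n] p' q
        by (auto simp: has_lead_def)
    next
      assume "k \<in> Poly_Mapping.keys (Poly_Mapping.single m c * q')"
      then obtain a b where "k = a + b" "a \<in> Poly_Mapping.keys (Poly_Mapping.single m c)"
          "b \<in> Poly_Mapping.keys q'"
        using keys_mult by blast
      then show ?thesis using term_order_add_strict[OF r, of b n m m] q'
        by (auto simp: add.commute split: if_splits)
    qed
  qed
  have "m + n \<notin> Poly_Mapping.keys s" using s term_order_irrefl[OF r] by blast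
  moreover have "k = m + n \<or> (k, m + n) \<in> r" if "k \<in> Poly_Mapping.keys (p * q)" for k
  proof -
    have "k \<in> Poly_Mapping.keys (Poly_Mapping.single (m + n) (c * e)) \<union> Poly_Mapping.keys s"
      using that keys_add[of _ s] unfolding pq by blast
    then show ?thesis using s by (auto split: if_splits)
  qed
  ultimately show ?thesis
    by (simp add: has_lead_def pq lookup_add in_keys_iff)
qed

lemma has_lead_power:
  fixes p :: "('v, 'k::comm_ring_1) mpoly"
  assumes "term_order r" "has_lead r (Poly_Mapping.single v 1) c p"
  shows "has_lead r (Poly_Mapping.single v n) (c ^ n) (p ^ n)"
proof (induction n)
  case 0
  show ?case using has_lead_single[of r 0 "1::'k"] by simp
next
  case (Suc n)
  then show ?case using has_lead_mult[OF assms(1,2), of "Poly_Mapping.single v n" "c ^ n" "p ^ n"]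
    by (simp flip: single_add)
qed

lemma has_lead_prod:
  fixes p :: "'a \<Rightarrow> ('v, 'k::comm_ring_1) mpoly"
  assumes "term_order r" "finite A" "\<And>a. a \<in> A \<Longrightarrow> has_lead r (m a) (c a) (p a)"
  shows "has_lead r (sum m A) (prod c A) (prod p A)"
  using assms(2,3)
proof (induction A rule: finite_induct)
  case empty
  show ?case using has_lead_single[of r 0 "1::'k"] by simp
next
  case (insert a A)
  then show ?case by (simp add: has_lead_mult[OF assms(1)])
qed

lemma initial_monomial_eqI:
  assumes "term_order r" "has_lead r m c p" "c \<noteq> 0"
  shows "initial_monomial r p = m"
  unfolding initial_monomial_def
proof (rule the_equality)
  show "m \<in> Poly_Mapping.keys p \<and> (\<forall>m'\<in>Poly_Mapping.keys p. m' \<noteq> m \<longrightarrow> (m', m) \<in> r)"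
    using assms by (auto simp: has_lead_def in_keys_iff)
  show "n = m" if "n \<in> Poly_Mapping.keys p \<and> (\<forall>m'\<in>Poly_Mapping.keys p. m' \<noteq> n \<longrightarrow> (m', n) \<in> r)" for n
    using assms that term_order_trans[OF assms(1)] term_order_irrefl[OF assms(1)]
    by (metis has_lead_def in_keys_iff)
qed

lemma has_lead_initial_monomial:
  assumes r: "term_order r" and "p \<noteq> 0"
  obtains c where "c \<noteq> 0" "has_lead r (initial_monomial r p) c p"
proof -
  have "\<exists>m\<in>A. \<forall>k\<in>A. k = m \<or> (k, m) \<in> r" if "finite A" "A \<noteq> {}" for A
    using that
  proof (induction A rule: finite_ne_induct)
    case (insert a A)
    then obtain m where m: "m \<in> A" "\<forall>k\<in>A. k = m \<or> (k, m) \<in> r" by blast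
    show ?case
    proof (cases "(m, a) \<in> r")
      case True
      then have "k = a \<or> (k, a) \<in> r" if "k \<in> insert a A" for k
        using that m term_order_trans[OF r, of k m a] by auto
      then show ?thesis by blast
    next
      case False
      then have "a = m \<or> (a, m) \<in> r" using term_order_total[OF r, of m a] by blast
      then show ?thesis using m by blast
    qed
  qed blast
  then obtain m where m: "m \<in> Poly_Mapping.keys p" "\<forall>k\<in>Poly_Mapping.keys p. k = m \<or> (k, m) \<in> r"
    using assms(2) by (metis finite_keys keys_eq_empty)
  then have "has_lead r m (Poly_Mapping.lookup p m) p" "Poly_Mapping.lookup p m \<noteq> 0"
    by (simp_all add: has_lead_def in_keys_iff)
  then show ?thesis using that initial_monomial_eqI[OF r] by metis
qed

section \<open>Monomials of an initial ideal\<close>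

lemma keys_monomial_ideal:
  fixes p :: "('v, 'k::comm_ring_1) mpoly"
  assumes "p \<in> ideal_gen ((\<lambda>m. Poly_Mapping.single m 1) ` M)" "k \<in> Poly_Mapping.keys p"
  shows "\<exists>m\<in>M. \<exists>n. k = n + m"
  using assms
proof (induction arbitrary: k rule: ideal_gen_induct)
  case (step c b q)
  then obtain m where m: "m \<in> M" "b = Poly_Mapping.single m 1" by blast
  have "k \<in> Poly_Mapping.keys (c * b) \<or> k \<in> Poly_Mapping.keys q"
    using step.prems keys_add[of "c * b" q] by blast
  then show ?case
  proof
    assume "k \<in> Poly_Mapping.keys (c * b)"
    then have "\<exists>n. k = n + m"
      using keys_mult[of c b] m by (auto split: if_splits)
    then show ?thesis using m by blast
  qed (use step.IH in blast)
qed simp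

lemma initial_ideal_conv_image:
  "initial_ideal r I = ideal_gen ((\<lambda>m. Poly_Mapping.single m 1) ` initial_monomial r ` (I - {0}))"
  by (simp add: initial_ideal_def image_image)

text \<open>The monomial is divisible by the initial monomial of some element; multiplying that
  element by the quotient monomial realises \<open>m\<close> itself as a leading monomial.\<close>

lemma monomial_in_initial_idealD:
  fixes B :: "('v, 'k::comm_ring_1) mpoly set"
  assumes r: "term_order r"
    and "Poly_Mapping.single m 1 \<in> initial_ideal r (ideal_gen B)"
  obtains p c where "p \<in> ideal_gen B" "c \<noteq> 0" "has_lead r m c p"
proof -
  obtain n k where "m = n + k" "k \<in> initial_monomial r ` (ideal_gen B - {0})"
    using keys_monomial_ideal[OF assms(2)[unfolded initial_ideal_conv_image], of m] by auto
  then obtain p where p: "p \<in> ideal_gen B" "p \<noteq> 0" "m = n + initial_monomial r p" by blast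
  obtain c where c: "c \<noteq> 0" "has_lead r (initial_monomial r p) c p"
    using has_lead_initial_monomial[OF r p(2)] .
  have "has_lead r m c (Poly_Mapping.single n 1 * p)"
    using has_lead_mult[OF r has_lead_single[of r n 1] c(2)] p(3) by simp
  then show ?thesis using that ideal_gen_mult[OF p(1)] c(1) by blast
qed

lemma monomial_in_initial_idealI:
  fixes p :: "('v, 'k::comm_ring_1) mpoly"
  assumes r: "term_order r" and "p \<in> I" "c \<noteq> 0" "has_lead r m c p"
  shows "Poly_Mapping.single m 1 \<in> initial_ideal r I"
proof -
  have "p \<noteq> 0" using assms by (auto simp: has_lead_def)
  then have "initial_monomial r p \<in> initial_monomial r ` (I - {0})" using assms by blast
  then have "m \<in> initial_monomial r ` (I - {0})"
    using initial_monomial_eqI[OF assms(1,4,3)] by simp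
  then show ?thesis
    unfolding initial_ideal_conv_image by (intro subsetD[OF ideal_gen_superset] imageI)
qed

section \<open>Upper triangular substitutions\<close>

lemma has_lead_matrix_act_Var:
  fixes b :: "'k::comm_ring_1^3^3"
  assumes "term_order r"
    and r: "(Poly_Mapping.single 2 1, Poly_Mapping.single 1 1) \<in> r"
      "(Poly_Mapping.single 3 1, Poly_Mapping.single 2 1) \<in> r"
    and b: "b $ 2 $ 1 = 0" "b $ 3 $ 1 = 0" "b $ 3 $ 2 = 0"
  shows "has_lead r (Poly_Mapping.single i 1) (b $ i $ i) (matrix_act b (Var i))"
proof -
  have r31: "(Poly_Mapping.single 3 1, Poly_Mapping.single 1 1) \<in> r"
    using term_order_trans[OF assms(1) r(2,1)] .
  have act: "matrix_act b (Var i) = (\<Sum>j\<in>UNIV. Poly_Mapping.single (Poly_Mapping.single j 1) (b $ i $ j))"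
    unfolding matrix_act_Var by (simp add: Const_def Var_def mult_single)
  have lk: "Poly_Mapping.lookup (matrix_act b (Var i)) k =
      (\<Sum>j\<in>UNIV. b $ i $ j when Poly_Mapping.single j 1 = k)" for k
    by (simp add: act lookup_sum lookup_single)
  have eq: "Poly_Mapping.single j (1::nat) = Poly_Mapping.single j' 1 \<longleftrightarrow> j = j'" for j j' :: 3
    by (metis keys_single singleton_inject zero_neq_one)
  have "Poly_Mapping.lookup (matrix_act b (Var i)) (Poly_Mapping.single i 1) = b $ i $ i"
    unfolding lk when_def eq by simp
  moreover have "k = Poly_Mapping.single i 1 \<or> (k, Poly_Mapping.single i 1) \<in> r"
    if "k \<in> Poly_Mapping.keys (matrix_act b (Var i))" for k
  proof -
    have "(\<Sum>j\<in>UNIV. b $ i $ j when Poly_Mapping.single j 1 = k) \<noteq> 0"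
      using that unfolding in_keys_iff lk .
    then obtain j where "(b $ i $ j when Poly_Mapping.single j 1 = k) \<noteq> 0"
      by (elim sum.not_neutral_contains_not_neutral)
    then have j: "b $ i $ j \<noteq> 0" "k = Poly_Mapping.single j 1"
      by (simp_all only: when_def split: if_splits) simp_all
    show ?thesis
      using j r r31 b exhaust_3[of i] exhaust_3[of j] by auto
  qed
  ultimately show ?thesis by (simp add: has_lead_def)
qed

text \<open>Each monomial is sent to a nonzero multiple of itself plus smaller monomials, so the
  image of the largest one cannot be cancelled.\<close>

lemma initial_monomial_matrix_act:
  fixes b :: "'k::field^3^3"
  assumes r: "term_order r" "(Poly_Mapping.single 2 1, Poly_Mapping.single 1 1) \<in> r"
      "(Poly_Mapping.single 3 1, Poly_Mapping.single 2 1) \<in> r"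
    and b: "b $ 2 $ 1 = 0" "b $ 3 $ 1 = 0" "b $ 3 $ 2 = 0"
    and diag: "\<And>i. b $ i $ i \<noteq> 0"
    and p: "p \<noteq> 0"
  shows "matrix_act b p \<noteq> 0" "initial_monomial r (matrix_act b p) = initial_monomial r p"
proof -
  define e where "e m = (\<Prod>i\<in>Poly_Mapping.keys m. b $ i $ i ^ Poly_Mapping.lookup m i)" for m :: "3 monomial"
  have e: "e m \<noteq> 0" for m using diag by (simp add: e_def)
  have single: "has_lead r m (c * e m) (matrix_act b (Poly_Mapping.single m c))" for m c
  proof -
    have "has_lead r (\<Sum>v\<in>Poly_Mapping.keys m. Poly_Mapping.single v (Poly_Mapping.lookup m v)) (e m)
        (\<Prod>v\<in>Poly_Mapping.keys m. matrix_act b (Var v) ^ Poly_Mapping.lookup m v)"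
      unfolding e_def using r b
      by (intro has_lead_prod has_lead_power has_lead_matrix_act_Var) auto
    moreover have "has_lead r 0 c (Const c :: (3, 'k) mpoly)"
      unfolding Const_def by (rule has_lead_single)
    ultimately have "has_lead r (0 + m) (c * e m) (Const c * 
        (\<Prod>v\<in>Poly_Mapping.keys m. matrix_act b (Var v) ^ Poly_Mapping.lookup m v))"
      by (intro has_lead_mult r(1)) (simp_all add: poly_mapping_sum_singles)
    then show ?thesis
      by (simp add: single_conv_prod matrix_act_simps del: matrix_act_Var)
  qed
  obtain c where c: "c \<noteq> 0" "has_lead r (initial_monomial r p) c p"
    using has_lead_initial_monomial[OF r(1) p] .
  define m where "m = initial_monomial r p"
  let ?t = "\<lambda>k. matrix_act b (Poly_Mapping.single k (Poly_Mapping.lookup p k))"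
  have act: "matrix_act b p = (\<Sum>k\<in>Poly_Mapping.keys p. ?t k)"
    by (subst (1) poly_mapping_sum_singles[of p, symmetric]) (simp only: matrix_act_simps)
  have below: "k = m \<or> (k, m) \<in> r" if "k \<in> Poly_Mapping.keys p" for k
    using c that by (simp add: has_lead_def m_def)
  have "m \<in> Poly_Mapping.keys p" using c by (simp add: has_lead_def m_def in_keys_iff)
  have "Poly_Mapping.lookup (?t k) m = (if k = m then c * e m else 0)" if k: "k \<in> Poly_Mapping.keys p" for k
  proof (cases "k = m")
    case True
    then show ?thesis using single[of m c] c by (simp add: has_lead_def m_def)
  next
    case False
    then have "(k, m) \<in> r" using below k by blast
    then have "m \<notin> Poly_Mapping.keys (?t k)"
      using single[of k "Poly_Mapping.lookup p k"] term_order_trans[OF r(1), of m k m]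
        term_order_irrefl[OF r(1), of m] unfolding has_lead_def by auto
    then show ?thesis using False by (simp add: in_keys_iff)
  qed
  then have "Poly_Mapping.lookup (matrix_act b p) m = c * e m"
    using \<open>m \<in> Poly_Mapping.keys p\<close> by (simp add: act lookup_sum)
  moreover have "k = m \<or> (k, m) \<in> r" if "k \<in> Poly_Mapping.keys (matrix_act b p)" for k
  proof -
    obtain l where l: "l \<in> Poly_Mapping.keys p" "k \<in> Poly_Mapping.keys (?t l)"
      using \<open>k \<in> _\<close> keys_sum_UN[of ?t] unfolding act by blast
    then have "k = l \<or> (k, l) \<in> r"
      using single unfolding has_lead_def by blast
    then show ?thesis using below[OF l(1)] term_order_trans[OF r(1), of k l m] by auto
  qed
  ultimately have lead: "has_lead r m (c * e m) (matrix_act b p)" by (simp add: has_lead_def)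
  have "c * e m \<noteq> 0" using c e by simp
  then show "initial_monomial r (matrix_act b p) = initial_monomial r p"
    using initial_monomial_eqI[OF r(1) lead] by (simp add: m_def)
  show "matrix_act b p \<noteq> 0"
    using lead \<open>c * e m \<noteq> 0\<close> by (auto simp: has_lead_def)
qed

lemma initial_ideal_matrix_act:
  fixes b :: "'k::field^3^3"
  assumes r: "term_order r" "(Poly_Mapping.single 2 1, Poly_Mapping.single 1 1) \<in> r"
      "(Poly_Mapping.single 3 1, Poly_Mapping.single 2 1) \<in> r"
    and b: "b $ 2 $ 1 = 0" "b $ 3 $ 1 = 0" "b $ 3 $ 2 = 0"
    and diag: "\<And>i. b $ i $ i \<noteq> 0"
  shows "initial_ideal r (matrix_act b ` I) = initial_ideal r I"
proof -
  note im = initial_monomial_matrix_act[OF r b diag]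
  have 0: "matrix_act b 0 = 0" by (rule matrix_act_simps)
  have "matrix_act b ` I - {0} = matrix_act b ` (I - {0})" using im(1) 0 by auto
  then have "initial_monomial r ` (matrix_act b ` I - {0}) = initial_monomial r ` (I - {0})"
    using im(2) by (simp add: image_image)
  then show ?thesis by (simp add: initial_ideal_conv_image)
qed

section \<open>Reduction to one explicit ideal\<close>

text \<open>This represents a generic coordinate change: swapping \<open>x\<close> and
  \<open>y\<close> turns \<open>y(x, y)^(d-1)\<close> into \<open>x(x, y)^(d-1)\<close>, whose
  linear factor is now the largest variable, and \<open>z\<close> becomes
  \<open>x + y + z\<close>.\<close>

definition reflect_shear :: "'k::field^3^3" where
  "reflect_shear = vector [vector [0, 1, 0], vector [1, 0, 0], vector [1, 1, 1]]"

lemma invertible_reflect_shear: "invertible (reflect_shear :: 'k::field^3^3)"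
  by (simp add: invertible_det_nz det_3 reflect_shear_def)

lemma matrix_act_Var3:
  "matrix_act g (Var i) = Const (g $ i $ 1) * Var 1 + Const (g $ i $ 2) * Var 2 + Const (g $ i $ 3) * Var 3"
  by (simp add: matrix_act_Var sum_3)

lemma Const_0 [simp]: "Const 0 = 0" and Const_1 [simp]: "Const 1 = 1"
  by (simp_all add: Const_def)

lemma reflect_shear_I_ideal:
  "matrix_act reflect_shear ` (I_ideal d :: (3, 'k::field) mpoly set) =
    ideal_gen ({Var 2 ^ a * Var 1 ^ (d - a) | a. a \<le> d - 1} \<union> {(Var 1 + Var 2 + Var 3) ^ d})"
proof -
  let ?A = "matrix_act (reflect_shear :: 'k^3^3)"
  have "?A (Var 1) = Var 2" "?A (Var 2) = Var 1" "?A (Var 3) = Var 1 + Var 2 + Var 3"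
    by (simp_all add: matrix_act_Var3 reflect_shear_def)
  moreover have "{Var 1 ^ a * Var 2 ^ (d - a) | a. a \<le> d - 1} =
      (\<lambda>a. Var 1 ^ a * Var 2 ^ (d - a) :: (3, 'k) mpoly) ` {..d - 1}"
    and "{Var 2 ^ a * Var 1 ^ (d - a) | a. a \<le> d - 1} =
      (\<lambda>a. Var 2 ^ a * Var 1 ^ (d - a) :: (3, 'k) mpoly) ` {..d - 1}"
    by auto
  ultimately show ?thesis
    unfolding I_ideal_def
    by (simp add: matrix_act_ideal_gen invertible_reflect_shear image_image
        is_ring_hom_mult[OF is_ring_hom_matrix_act] is_ring_hom_power[OF is_ring_hom_matrix_act])
qed

text \<open>\<open>y\<close> and \<open>z\<close> go to multiples of themselves and \<open>x\<close>
  to a combination of \<open>x\<close> and \<open>y\<close>. Expanding a generator keeps the degree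
  \<open>d\<close> in \<open>x\<close> and \<open>y\<close> and never raises the exponent of
  \<open>x\<close>.\<close>

lemma matrix_act_I_ideal_subset:
  fixes s :: "'k::field^3^3"
  assumes s: "s $ 1 $ 3 = 0" "s $ 2 $ 1 = 0" "s $ 2 $ 3 = 0" "s $ 3 $ 1 = 0" "s $ 3 $ 2 = 0"
    and inv: "invertible s"
  shows "matrix_act s ` I_ideal d \<subseteq> I_ideal d"
proof -
  define X Y Z where "X = Const (s $ 1 $ 1) * Var 1 + Const (s $ 1 $ 2) * (Var 2 :: (3, 'k) mpoly)"
    and "Y = Const (s $ 2 $ 2) * (Var 2 :: (3, 'k) mpoly)" and "Z = Const (s $ 3 $ 3) * (Var 3 :: (3, 'k) mpoly)"
  let ?B = "{Var 1 ^ a * Var 2 ^ (d - a) | a. a \<le> d - 1} \<union> {Var 3 ^ d} :: (3, 'k) mpoly set"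
  have XYZ: "matrix_act s (Var 1) = X" "matrix_act s (Var 2) = Y" "matrix_act s (Var 3) = Z"
    using s by (simp_all add: matrix_act_Var3 X_def Y_def Z_def)
  have mem: "c * (Var 1 ^ k * Var 2 ^ (d - k)) \<in> ideal_gen ?B" if "k \<le> d - 1" for k c
    using that by (intro ideal_gen_mult subsetD[OF ideal_gen_superset]) auto
  have "matrix_act s b \<in> ideal_gen ?B" if "b \<in> ?B" for b
  proof -
    from that consider a where "a \<le> d - 1" "b = Var 1 ^ a * Var 2 ^ (d - a)" | "b = Var 3 ^ d"
      unfolding Un_iff mem_Collect_eq by (elim disjE exE conjE) simp_all
    from this show ?thesis
    proof cases
      case 1
      have "matrix_act s b = X ^ a * Y ^ (d - a)"
        unfolding 1 is_ring_hom_mult[OF is_ring_hom_matrix_act] is_ring_hom_power[OF is_ring_hom_matrix_act] XYZ ..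
      also have "\<dots> = (\<Sum>k\<le>a. of_nat (a choose k) * (Const (s $ 1 $ 1) * Var 1) ^ k *
          (Const (s $ 1 $ 2) * Var 2) ^ (a - k) * (Const (s $ 2 $ 2) * Var 2) ^ (d - a))"
        unfolding X_def Y_def binomial_ring sum_distrib_right ..
      also have "\<dots> = (\<Sum>k\<le>a. (of_nat (a choose k) * Const (s $ 1 $ 1) ^ k * Const (s $ 1 $ 2) ^ (a - k) *
          Const (s $ 2 $ 2) ^ (d - a)) * (Var 1 ^ k * Var 2 ^ (d - k)))"
      proof (rule sum.cong)
        fix k assume "k \<in> {..a}"
        then have "d - k = (a - k) + (d - a)" using 1(1) by auto
        then show "of_nat (a choose k) * (Const (s $ 1 $ 1) * Var 1) ^ k *
            (Const (s $ 1 $ 2) * Var 2) ^ (a - k) * (Const (s $ 2 $ 2) * Var 2) ^ (d - a) =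
            (of_nat (a choose k) * Const (s $ 1 $ 1) ^ k * Const (s $ 1 $ 2) ^ (a - k) *
            Const (s $ 2 $ 2) ^ (d - a)) * (Var 1 ^ k * Var 2 ^ (d - k) :: (3, 'k) mpoly)"
          by (simp only: power_mult_distrib power_add mult_ac)
      qed simp
      finally have act: "matrix_act s b = \<dots>" .
      show ?thesis unfolding act using 1(1) by (intro ideal_gen_sum mem) simp
    next
      case 2
      have "matrix_act s b = Const (s $ 3 $ 3) ^ d * Var 3 ^ d"
        unfolding 2 is_ring_hom_power[OF is_ring_hom_matrix_act] XYZ Z_def power_mult_distrib ..
      then show ?thesis by (simp add: ideal_gen_mult subsetD[OF ideal_gen_superset])
    qed
  qed
  then show ?thesis
    unfolding I_ideal_def matrix_act_ideal_gen[OF inv] by (intro ideal_gen_subsetI image_subsetI)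
qed

lemma matrix_act_I_ideal:
  fixes s :: "'k::field^3^3"
  assumes s: "s $ 1 $ 3 = 0" "s $ 2 $ 1 = 0" "s $ 2 $ 3 = 0" "s $ 3 $ 1 = 0" "s $ 3 $ 2 = 0"
    and diag: "s $ 1 $ 1 \<noteq> 0" "s $ 2 $ 2 \<noteq> 0" "s $ 3 $ 3 \<noteq> 0"
  shows "matrix_act s ` I_ideal d = I_ideal d"
proof
  have "invertible s" using s diag by (simp add: invertible_det_nz det_3)
  then show "matrix_act s ` I_ideal d \<subseteq> I_ideal d" using s by (intro matrix_act_I_ideal_subset)
  \<comment> \<open>The inverse of \<open>s\<close>, which has the same zero pattern and therefore
    also maps the ideal into itself.\<close>
  define t :: "'k^3^3" where "t = vector [vector [1 / s $ 1 $ 1, - s $ 1 $ 2 / (s $ 1 $ 1 * s $ 2 $ 2), 0],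
    vector [0, 1 / s $ 2 $ 2, 0], vector [0, 0, 1 / s $ 3 $ 3]]"
  have t: "matrix_act t ` I_ideal d \<subseteq> I_ideal d"
    using diag by (intro matrix_act_I_ideal_subset) (simp_all add: t_def invertible_det_nz det_3)
  have "t ** s = mat 1"
    using s diag by (simp add: vec_eq_iff forall_3 matrix_matrix_mult_def sum_3 t_def mat_def field_simps)
  then have "matrix_act s (matrix_act t p) = p" for p by (simp add: matrix_act_comp matrix_act_mat_1)
  then show "I_ideal d \<subseteq> matrix_act s ` I_ideal d" using t by (metis image_iff image_subset_iff subsetI)
qed

text \<open>In \<open>s ** reflect_shear ** b\<close> the second row is a multiple of the first row
  of \<open>b\<close>, the first row combines the first two rows of \<open>b\<close>, and the third
  row is a multiple of the sum of all three. Comparing with \<open>g\<close> determines the rows of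
  \<open>b\<close> up to scale.\<close>

lemma generic_matrix_decomposition:
  fixes g :: "'k::field^3^3"
  assumes "invertible g"
    and nz: "g $ 2 $ 1 \<noteq> 0" "g $ 3 $ 1 \<noteq> 0" "g $ 2 $ 1 * g $ 1 $ 2 - g $ 1 $ 1 * g $ 2 $ 2 \<noteq> 0"
      "g $ 3 $ 2 * g $ 2 $ 1 - g $ 3 $ 1 * g $ 2 $ 2 \<noteq> 0"
  obtains s b where "g = s ** reflect_shear ** b"
    "s $ 1 $ 3 = 0" "s $ 2 $ 1 = 0" "s $ 2 $ 3 = 0" "s $ 3 $ 1 = 0" "s $ 3 $ 2 = 0"
    "s $ 1 $ 1 \<noteq> 0" "s $ 2 $ 2 \<noteq> 0" "s $ 3 $ 3 \<noteq> 0"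
    "b $ 2 $ 1 = 0" "b $ 3 $ 1 = 0" "b $ 3 $ 2 = 0" "\<And>i. b $ i $ i \<noteq> 0"
proof -
  define M N where "M = g $ 2 $ 1 * g $ 1 $ 2 - g $ 1 $ 1 * g $ 2 $ 2"
    and "N = g $ 3 $ 2 * g $ 2 $ 1 - g $ 3 $ 1 * g $ 2 $ 2"
  \<comment> \<open>These scale the first two rows of \<open>b\<close> so that their sum agrees with
    the third row of \<open>g\<close> in columns 1 and 2; \<open>c\<close> then makes up the
    difference in column 3.\<close>
  define \<alpha> \<beta> where "\<alpha> = g $ 3 $ 1 / g $ 2 $ 1" and "\<beta> = N / (g $ 2 $ 1 * M)"
  have MN: "M \<noteq> 0" "N \<noteq> 0" and \<alpha>\<beta>: "\<alpha> \<noteq> 0" "\<beta> \<noteq> 0"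
    using nz by (simp_all add: M_def N_def \<alpha>_def \<beta>_def)
  \<comment> \<open>A multiple of row 1 of \<open>g\<close> with its first entry cleared by row 2,
    so \<open>m 1 = 0\<close> and \<open>m 2 = M\<close>.\<close>
  define m where "m j = g $ 2 $ 1 * g $ 1 $ j - g $ 1 $ 1 * g $ 2 $ j" for j
  define c where "c = g $ 3 $ 3 - \<alpha> * g $ 2 $ 3 - \<beta> * m 3"
  define b :: "'k^3^3" where "b = vector [vector [\<alpha> * g $ 2 $ 1, \<alpha> * g $ 2 $ 2, \<alpha> * g $ 2 $ 3],
    vector [0, \<beta> * M, \<beta> * m 3], vector [0, 0, c]]"
  define s :: "'k^3^3" where "s = vector [vector [1 / (\<beta> * g $ 2 $ 1), g $ 1 $ 1 / (g $ 2 $ 1 * \<alpha>), 0],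
    vector [0, 1 / \<alpha>, 0], vector [0, 0, 1]]"
  have \<alpha>1: "\<alpha> * g $ 2 $ 1 = g $ 3 $ 1" using nz by (simp add: \<alpha>_def)
  have "\<beta> * M = N / g $ 2 $ 1" using MN by (simp add: \<beta>_def)
  then have \<beta>2: "\<beta> * M = g $ 3 $ 2 - \<alpha> * g $ 2 $ 2" using nz by (simp add: N_def \<alpha>_def diff_divide_distrib)
  have row: "(s ** reflect_shear ** b) $ i $ j =
      s $ i $ 1 * b $ 2 $ j + s $ i $ 2 * b $ 1 $ j + s $ i $ 3 * (b $ 1 $ j + b $ 2 $ j + b $ 3 $ j)" for i j
  proof -
    have "(s ** reflect_shear) $ i $ 1 = s $ i $ 2 + s $ i $ 3" "(s ** reflect_shear) $ i $ 2 = s $ i $ 1 + s $ i $ 3"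
        "(s ** reflect_shear) $ i $ 3 = s $ i $ 3"
      by (simp_all add: matrix_matrix_mult_def sum_3 reflect_shear_def)
    then have "(s ** reflect_shear ** b) $ i $ j = (s $ i $ 2 + s $ i $ 3) * b $ 1 $ j +
        (s $ i $ 1 + s $ i $ 3) * b $ 2 $ j + s $ i $ 3 * b $ 3 $ j"
      unfolding matrix_matrix_mult_def[of _ b] by (simp add: sum_3)
    then show ?thesis by (simp only: distrib_left distrib_right ac_simps)
  qed
  have b1: "b $ 1 $ j = \<alpha> * g $ 2 $ j" for j
    using exhaust_3[of j] by (auto simp: b_def)
  have b2: "b $ 2 $ j = \<beta> * m j" for j
    using exhaust_3[of j] by (auto simp: b_def m_def M_def)
  have "(s ** reflect_shear ** b) $ 1 $ j = g $ 1 $ j" for j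
  proof -
    have "(s ** reflect_shear ** b) $ 1 $ j = m j / g $ 2 $ 1 + g $ 1 $ 1 * g $ 2 $ j / g $ 2 $ 1"
      unfolding row b1 b2 using \<alpha>\<beta> by (simp add: s_def)
    then show ?thesis using nz by (simp add: m_def flip: add_divide_distrib)
  qed
  moreover have "(s ** reflect_shear ** b) $ 2 $ j = g $ 2 $ j" for j
    unfolding row b1 b2 using \<alpha>\<beta> by (simp add: s_def)
  moreover have "(s ** reflect_shear ** b) $ 3 $ j = g $ 3 $ j" for j
    using exhaust_3[of j] \<alpha>1 \<beta>2 unfolding row by (auto simp: s_def b_def c_def)
  ultimately have g: "g = s ** reflect_shear ** b"
    by (simp add: vec_eq_iff forall_3)
  \<comment> \<open>The invertibility of \<open>g\<close> passes to \<open>b\<close> and excludes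
    \<open>c = 0\<close>.\<close>
  have "det b = \<alpha> * g $ 2 $ 1 * (\<beta> * M) * c" by (simp add: det_3 b_def)
  moreover have "det b \<noteq> 0"
    using assms(1) unfolding invertible_det_nz g det_mul by simp
  ultimately have c: "c \<noteq> 0" by auto
  have bi: "b $ i $ i \<noteq> 0" for i
    using exhaust_3[of i] c nz MN \<alpha>\<beta> by (auto simp: b_def)
  show ?thesis
    by (rule that[OF g _ _ _ _ _ _ _ _ _ _ _ bi]) (use nz \<alpha>\<beta> in \<open>simp_all add: s_def b_def\<close>)
qed

lemma is_gin_I_ideal:
  fixes r :: "3 monomial rel"
  assumes r: "term_order r" "(Poly_Mapping.single 2 1, Poly_Mapping.single 1 1) \<in> r"
      "(Poly_Mapping.single 3 1, Poly_Mapping.single 2 1) \<in> r"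
  shows "is_gin r (I_ideal d :: (3, 'k::field) mpoly set)
    (initial_ideal r (matrix_act reflect_shear ` I_ideal d))"
proof -
  \<comment> \<open>The two entries and two minors required by the factorisation, multiplied
    together so that one nonvanishing condition describes the open set.\<close>
  define p :: "(3 \<times> 3, 'k) mpoly" where "p = Var (2, 1) * Var (3, 1) *
    (Var (2, 1) * Var (1, 2) - Var (1, 1) * Var (2, 2)) * (Var (3, 2) * Var (2, 1) - Var (3, 1) * Var (2, 2))"
  let ?e = "\<lambda>g :: 'k^3^3. eval_mpoly (\<lambda>c. c) (\<lambda>(i, j). g $ i $ j)"
  define U where "U = {g :: 'k^3^3. invertible g \<and> (\<exists>q\<in>{p}. ?e g q \<noteq> 0)}"
  have hom: "is_ring_hom (\<lambda>c :: 'k. c)" by (simp add: is_ring_hom_def)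
  note ehom = is_ring_hom_eval_mpoly[OF hom]
  have e: "?e g p = g $ 2 $ 1 * g $ 3 $ 1 * (g $ 2 $ 1 * g $ 1 $ 2 - g $ 1 $ 1 * g $ 2 $ 2) *
      (g $ 3 $ 2 * g $ 2 $ 1 - g $ 3 $ 1 * g $ 2 $ 2)" for g
    by (simp add: p_def is_ring_hom_mult[OF ehom] is_ring_hom_diff[OF ehom] eval_mpoly_Var[OF hom])
  have "zariski_open_GL3 U" unfolding zariski_open_GL3_def U_def by blast
  \<comment> \<open>All four factors equal 1 at \<open>reflect_shear\<close>, so the open set is
    nonempty.\<close>
  moreover have "reflect_shear \<in> U"
    unfolding U_def using invertible_reflect_shear by (simp add: e) (simp add: reflect_shear_def)
  moreover have "initial_ideal r (matrix_act g ` I_ideal d) =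
      initial_ideal r (matrix_act reflect_shear ` I_ideal d)" if "g \<in> U" for g
  proof -
    have "invertible g" "g $ 2 $ 1 \<noteq> 0" "g $ 3 $ 1 \<noteq> 0" "g $ 2 $ 1 * g $ 1 $ 2 - g $ 1 $ 1 * g $ 2 $ 2 \<noteq> 0"
        "g $ 3 $ 2 * g $ 2 $ 1 - g $ 3 $ 1 * g $ 2 $ 2 \<noteq> 0"
      using that by (simp_all add: U_def e)
    then obtain s b where g: "g = s ** reflect_shear ** b"
      and s: "s $ 1 $ 3 = 0" "s $ 2 $ 1 = 0" "s $ 2 $ 3 = 0" "s $ 3 $ 1 = 0" "s $ 3 $ 2 = 0"
        "s $ 1 $ 1 \<noteq> 0" "s $ 2 $ 2 \<noteq> 0" "s $ 3 $ 3 \<noteq> 0"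
      and b: "b $ 2 $ 1 = 0" "b $ 3 $ 1 = 0" "b $ 3 $ 2 = 0" "\<And>i. b $ i $ i \<noteq> 0"
      by (rule generic_matrix_decomposition) blast
    \<comment> \<open>\<open>s\<close> acts first and preserves the ideal; \<open>b\<close> acts
      last and does not change the initial ideal.\<close>
    have "matrix_act g ` I_ideal d = matrix_act b ` matrix_act reflect_shear ` matrix_act s ` I_ideal d"
      by (simp add: g image_image matrix_act_comp matrix_mul_assoc)
    then show ?thesis
      by (simp add: matrix_act_I_ideal[OF s] initial_ideal_matrix_act[OF r b])
  qed
  ultimately show ?thesis unfolding is_gin_def by (intro exI[of _ U] conjI ballI) (assumption | blast)+
qed

section \<open>Rows of multiples of a power of a linear form\<close>

text \<open>Used with coefficients in \<open>K[x]\<close>, \<open>a = 1 + x\<close> and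
  \<open>q\<close> a polynomial in \<open>z\<close>.\<close>

lemma coeff_linear_power_mult:
  fixes q :: "'a::comm_semiring_1 poly"
  assumes "c \<le> d"
  shows "coeff ([:a, 1:] ^ d * q) c = (\<Sum>i\<le>c. of_nat (d choose (c - i)) * a ^ (d - (c - i)) * coeff q i)"
proof -
  have "coeff ([:a, 1:] ^ d * q) c = (\<Sum>i\<le>c. coeff q i * coeff ([:a, 1:] ^ d) (c - i))"
    by (subst mult.commute) (rule coeff_mult)
  also have "\<dots> = (\<Sum>i\<le>c. of_nat (d choose (c - i)) * a ^ (d - (c - i)) * coeff q i)"
    using assms by (intro sum.cong) (simp_all add: coeff_linear_poly_power mult.commute)
  finally show ?thesis .
qed

text \<open>
  Here \<open>\<beta> \<in> K[x][z]\<close> is the dehomogenised cofactor \<open>B\<close> with \<open>y = 1\<close>, and \<open>[:[:1, 1:], 1:]\<close> is \<open>1 + x + z\<close>.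
\<close>

lemma row_not_small:
  fixes \<beta> :: "'k::field_char_0 poly poly"
  assumes k: "k + m + 1 < d" and high: "\<And>i. k < i \<Longrightarrow> coeff \<beta> i = 0"
    and col: "\<And>c. c < k \<Longrightarrow> coeff (coeff ([:[:1, 1:], 1:] ^ d * \<beta>) c) 0 = 0"
      "coeff (coeff ([:[:1, 1:], 1:] ^ d * \<beta>) k) 0 \<noteq> 0"
  shows "\<exists>a>m. coeff (coeff ([:[:1, 1:], 1:] ^ d * \<beta>) (k + 1)) a \<noteq> 0"
proof (rule ccontr)
  define u where "u = [:1, 1:: 'k:]"
  define g where "g = [:u, 1:] ^ d * \<beta>"
  assume "\<not> ?thesis"
  then have row: "coeff (coeff g (k + 1)) a = 0" if "m < a" for a
    using that by (auto simp: g_def u_def)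
  have u0: "coeff u 0 = 1" by (simp add: u_def)
  \<comment> \<open>At \<open>x = 0\<close> the form \<open>1 + x\<close> becomes 1, so the constant
    terms of the rows of \<open>\<beta>\<close> satisfy a triangular system with unit diagonal.
    Solving it row by row shows that they vanish below row \<open>k\<close> but not in row
    \<open>k\<close>.\<close>
  have col0: "coeff (coeff g c) 0 = (\<Sum>i\<le>c. of_nat (d choose (c - i)) * coeff (coeff \<beta> i) 0)"
    if "c \<le> d" for c
    unfolding g_def coeff_linear_power_mult[OF that]
    by (simp add: coeff_sum coeff_mult_0 coeff_0_power of_nat_poly u0)
  have col0': "coeff (coeff g c) 0 = coeff (coeff \<beta> c) 0"
    if "c \<le> k" "\<And>i. i < c \<Longrightarrow> coeff (coeff \<beta> i) 0 = 0" for c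
  proof -
    have "coeff (coeff g c) 0 = (\<Sum>i\<le>c. of_nat (d choose (c - i)) * coeff (coeff \<beta> i) 0)"
      using k that(1) by (intro col0) simp
    also have "\<dots> = (\<Sum>i\<in>{c}. of_nat (d choose (c - i)) * coeff (coeff \<beta> i) 0)"
      by (rule sum.mono_neutral_right) (use that(2) in auto)
    finally show ?thesis by simp
  qed
  have low: "coeff (coeff \<beta> c) 0 = 0" if "c < k" for c
    using that
  proof (induction c rule: less_induct)
    case (less c)
    then show ?case using col0'[of c] col(1)[of c] by (simp add: g_def u_def)
  qed
  have \<beta>k: "coeff (coeff \<beta> k) 0 \<noteq> 0"
    using col0'[of k] low col(2) by (simp add: g_def u_def)
  \<comment> \<open>As \<open>\<beta>\<close> has no row beyond \<open>k\<close>, every contribution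
    to row \<open>k + 1\<close> contains the power \<open>d - 1 - k\<close> of \<open>u\<close>;
    \<open>Q\<close> is what remains.\<close>
  define Q where "Q = (\<Sum>i\<le>k. of_nat (d choose (k + 1 - i)) * u ^ i * coeff \<beta> i)"
  have "coeff g (k + 1) = (\<Sum>i\<le>k. of_nat (d choose (k + 1 - i)) * u ^ (d - (k + 1 - i)) * coeff \<beta> i)"
    unfolding g_def using k high by (subst coeff_linear_power_mult) simp_all
  also have "\<dots> = u ^ (d - 1 - k) * Q"
    unfolding Q_def sum_distrib_left
  proof (rule sum.cong)
    fix i assume "i \<in> {..k}"
    then have "d - (k + 1 - i) = (d - 1 - k) + i" using k by auto
    then show "of_nat (d choose (k + 1 - i)) * u ^ (d - (k + 1 - i)) * coeff \<beta> i =
        u ^ (d - 1 - k) * (of_nat (d choose (k + 1 - i)) * u ^ i * coeff \<beta> i)"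
      by (simp only: power_add mult_ac)
  qed simp
  finally have gQ: "coeff g (k + 1) = u ^ (d - 1 - k) * Q" .
  \<comment> \<open>A nonzero \<open>Q\<close> would give row \<open>k + 1\<close> degree at least
    \<open>d - 1 - k\<close>, which exceeds \<open>m\<close>.\<close>
  have "Q = 0"
  proof (rule ccontr)
    assume "Q \<noteq> 0"
    have "u \<noteq> 0" by (simp add: u_def)
    then have "coeff g (k + 1) \<noteq> 0" using gQ \<open>Q \<noteq> 0\<close> by simp
    moreover have deg: "degree (coeff g (k + 1)) = d - 1 - k + degree Q"
      unfolding gQ using \<open>u \<noteq> 0\<close> \<open>Q \<noteq> 0\<close>
      by (subst degree_mult_eq) (simp_all add: u_def degree_linear_power)
    moreover have "coeff (coeff g (k + 1)) (degree (coeff g (k + 1))) = 0"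
      using k deg by (intro row) simp
    ultimately show False by (metis leading_coeff_0_iff)
  qed
  \<comment> \<open>Only \<open>i = k\<close> survives at \<open>x = 0\<close>; its factor
    \<open>d choose 1 = d\<close> is nonzero in characteristic 0.\<close>
  moreover have "coeff Q 0 = (\<Sum>i\<in>{k}. of_nat (d choose (k + 1 - i)) * coeff (coeff \<beta> i) 0)"
    unfolding Q_def coeff_sum coeff_mult_0 coeff_0_power u0
    using low by (subst sum.mono_neutral_right[of _ "{k}"])
      (auto simp: coeff_mult_0 coeff_0_power u0 of_nat_poly)
  ultimately show False using \<beta>k k by simp
qed

text \<open>The cofactor \<open>z^k + \<kappa> (y^k - (x + y)^k)\<close> at \<open>y = 1\<close>.
  The correction vanishes at \<open>x = 0\<close>, and its scale makes the terms in
  \<open>(1 + x)^(d - 1)\<close> cancel in row \<open>k + 1\<close> of the product with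
  \<open>(1 + x + z)^d\<close>.\<close>

definition witness_row :: "nat \<Rightarrow> nat \<Rightarrow> 'k::field_char_0 poly poly" where
  "witness_row d k = monom 1 k + [:smult (of_nat d / of_nat (d choose (k + 1))) (1 - [:1, 1:] ^ k):]"

lemma witness_row_products:
  assumes "0 < k" "k < d"
  shows "c \<le> k \<Longrightarrow> coeff (coeff ([:[:1, 1:], 1:] ^ d * witness_row d k) c) 0 = (if c = k then 1 else 0 :: 'k::field_char_0)"
    and "d - 1 - k < a \<Longrightarrow> coeff (coeff ([:[:1, 1:], 1:] ^ d * witness_row d k) (k + 1)) a = (0 :: 'k)"
proof -
  define u where "u = [:1, 1:: 'k:]"
  define \<kappa> where "\<kappa> = (of_nat d / of_nat (d choose (k + 1)) :: 'k)"
  have \<kappa>: "of_nat (d choose (k + 1)) * \<kappa> = of_nat d"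
    using assms by (simp add: \<kappa>_def)
  have w: "coeff (witness_row d k) i = (if i = k then 1 else if i = 0 then smult \<kappa> (1 - u ^ k) else 0)" for i
    using assms by (auto simp: witness_row_def \<kappa>_def u_def coeff_pCons split: nat.splits)
  have u0: "coeff u 0 = 1" by (simp add: u_def)
  have w0: "coeff (coeff (witness_row d k) i) 0 = (if i = k then 1 else 0 :: 'k)" for i
    by (simp add: w coeff_0_power u0)
  show "coeff (coeff ([:[:1, 1:], 1:] ^ d * witness_row d k) c) 0 = (if c = k then 1 else 0 :: 'k)" if "c \<le> k"
  proof -
    have "coeff (coeff ([:u, 1:] ^ d * witness_row d k) c) 0 =
        (\<Sum>i\<le>c. of_nat (d choose (c - i)) * (if i = k then 1 else 0))"
      using that assms by (subst coeff_linear_power_mult)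
        (simp_all add: coeff_sum coeff_mult_0 coeff_0_power of_nat_poly u0 w0)
    also have "\<dots> = (if c = k then 1 else 0)" using that by (auto simp: if_distrib cong: if_cong)
    finally show ?thesis by (simp add: u_def)
  qed
  show "coeff (coeff ([:[:1, 1:], 1:] ^ d * witness_row d k) (k + 1)) a = (0 :: 'k)" if "d - 1 - k < a"
  proof -
    have "coeff ([:u, 1:] ^ d * witness_row d k) (k + 1) =
        (\<Sum>i\<in>{0, k}. of_nat (d choose (k + 1 - i)) * u ^ (d - (k + 1 - i)) * coeff (witness_row d k) i)"
      unfolding coeff_linear_power_mult[OF Suc_leI[OF assms(2), unfolded Suc_eq_plus1]]
      by (rule sum.mono_neutral_right) (use assms in \<open>auto simp: w\<close>)
    also have "\<dots> = of_nat (d choose (k + 1)) * u ^ (d - (k + 1)) * smult \<kappa> (1 - u ^ k) + of_nat d * u ^ (d - 1)"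
      using assms by (simp add: w)
    also have "of_nat (d choose (k + 1)) * u ^ (d - (k + 1)) * smult \<kappa> (1 - u ^ k) =
        smult (of_nat (d choose (k + 1)) * \<kappa>) (u ^ (d - (k + 1)) * (1 - u ^ k))"
      by (simp add: of_nat_poly mult.commute)
    also have "\<dots> = smult (of_nat d) (u ^ (d - (k + 1)) - u ^ (d - 1))"
      unfolding \<kappa> using assms by (simp add: algebra_simps flip: power_add)
    also have "\<dots> + of_nat d * u ^ (d - 1) = smult (of_nat d) (u ^ (d - (k + 1)))"
      by (simp add: of_nat_poly smult_diff_right)
    finally have "coeff ([:u, 1:] ^ d * witness_row d k) (k + 1) = smult (of_nat d) (u ^ (d - (k + 1)))" .
    moreover have "coeff (u ^ (d - (k + 1))) a = 0"
      using that by (intro coeff_eq_0) (simp add: u_def degree_linear_power)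
    ultimately show ?thesis by (simp add: u_def)
  qed
qed

section \<open>A term order adapted to the grid of exponents\<close>

definition mon :: "nat \<Rightarrow> nat \<Rightarrow> nat \<Rightarrow> 3 monomial" where
  "mon a b c = Poly_Mapping.single 1 a + Poly_Mapping.single 2 b + Poly_Mapping.single 3 c"

lemma lookup_mon [simp]:
  "Poly_Mapping.lookup (mon a b c) 1 = a" "Poly_Mapping.lookup (mon a b c) 2 = b"
  "Poly_Mapping.lookup (mon a b c) 3 = c"
  by (simp_all add: mon_def lookup_add lookup_single)

lemma monomial_eq_iff:
  "m = n \<longleftrightarrow> Poly_Mapping.lookup m 1 = Poly_Mapping.lookup n 1 \<and>
    Poly_Mapping.lookup m 2 = Poly_Mapping.lookup n 2 \<and> Poly_Mapping.lookup m 3 = Poly_Mapping.lookup n 3"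
  for m n :: "3 monomial"
  by (simp add: poly_mapping_eq_iff fun_eq_iff forall_3)

lemma mon_lookup: "mon (Poly_Mapping.lookup m 1) (Poly_Mapping.lookup m 2) (Poly_Mapping.lookup m 3) = m"
  by (simp add: monomial_eq_iff)

lemma mon_eq_iff [simp]: "mon a b c = mon a' b' c' \<longleftrightarrow> a = a' \<and> b = b' \<and> c = c'"
  by (simp add: monomial_eq_iff)

text \<open>Within degree \<open>d + k\<close>, the monomial \<open>x^a y^b z^(k+j)\<close> weighs
  at most as much as \<open>y^d z^k\<close> exactly when \<open>a \<le> m * j\<close>. The final
  comparison separates powers of \<open>z\<close>, which has weight 0.\<close>

definition grid_order :: "nat \<Rightarrow> 3 monomial rel" where
  "grid_order m = {(s, t). let w = (\<lambda>u. (m + 1) * Poly_Mapping.lookup u 1 + m * Poly_Mapping.lookup u 2) in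
    w s < w t \<or> w s = w t \<and> (Poly_Mapping.lookup s 2 < Poly_Mapping.lookup t 2 \<or>
      Poly_Mapping.lookup s 2 = Poly_Mapping.lookup t 2 \<and> Poly_Mapping.lookup s 3 < Poly_Mapping.lookup t 3)}"

lemma mon_in_grid_order:
  "(mon a b c, mon a' b' c') \<in> grid_order m \<longleftrightarrow>
    (m + 1) * a + m * b < (m + 1) * a' + m * b' \<or>
    (m + 1) * a + m * b = (m + 1) * a' + m * b' \<and> (b < b' \<or> b = b' \<and> c < c')"
  by (simp add: grid_order_def)

lemma term_order_grid_order:
  assumes "0 < m"
  shows "term_order (grid_order m)"
proof -
  have "trans (grid_order m)" by (rule transI) (auto simp: grid_order_def Let_def)
  moreover have "irrefl (grid_order m)" by (auto simp: irrefl_def grid_order_def)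
  moreover have "total (grid_order m)"
  proof (rule totalI)
    fix s t :: "3 monomial" assume "s \<noteq> t"
    obtain a b c a' b' c' where [simp]: "s = mon a b c" "t = mon a' b' c'" by (metis mon_lookup)
    have "a = a'" if "(m + 1) * a + m * b = (m + 1) * a' + m * b'" "b = b'"
      using that by (metis add_right_cancel mult_cancel1 add_is_0 one_neq_zero)
    then show "(s, t) \<in> grid_order m \<or> (t, s) \<in> grid_order m"
      using \<open>s \<noteq> t\<close> unfolding \<open>s = _\<close> \<open>t = _\<close> mon_in_grid_order mon_eq_iff by linarith
  qed
  moreover have "(s + u, t + u) \<in> grid_order m" if "(s, t) \<in> grid_order m" for s t u
    using that unfolding grid_order_def Let_def mem_Collect_eq case_prod_conv lookup_add distrib_left
    by linarith
  moreover have "(0, t) \<in> grid_order m" if "t \<noteq> 0" for t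
  proof -
    have "Poly_Mapping.lookup t 1 \<noteq> 0 \<or> Poly_Mapping.lookup t 2 \<noteq> 0 \<or> Poly_Mapping.lookup t 3 \<noteq> 0"
      using that by (simp add: monomial_eq_iff)
    then show ?thesis using assms by (auto simp: grid_order_def Let_def)
  qed
  ultimately show ?thesis by (simp add: term_order_def strict_linear_order_on_def)
qed

lemma variables_in_grid_order:
  assumes "0 < m"
  shows "(Poly_Mapping.single 2 1, Poly_Mapping.single 1 1) \<in> grid_order m"
    and "(Poly_Mapping.single 3 1, Poly_Mapping.single 2 1) \<in> grid_order m"
proof -
  have "Poly_Mapping.single 1 1 = mon 1 0 0" "Poly_Mapping.single 2 1 = mon 0 1 0"
      "Poly_Mapping.single 3 1 = mon 0 0 1"
    by (simp_all add: mon_def)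
  then show "(Poly_Mapping.single 2 1, Poly_Mapping.single 1 1) \<in> grid_order m"
    and "(Poly_Mapping.single 3 1, Poly_Mapping.single 2 1) \<in> grid_order m"
    using assms by (simp_all only: mon_in_grid_order) simp_all
qed

section \<open>Dehomogenisation\<close>

text \<open>
  The homomorphism \<open>x \<mapsto> xT\<close>, \<open>y \<mapsto> T\<close>, \<open>z \<mapsto> zT\<close> to \<open>K[x][z][T]\<close>: it loses nothing, since the power of \<open>T\<close>
  records the degree, and it makes single coefficients of products accessible.
\<close>

definition dehom :: "(3, 'k::field_char_0) mpoly \<Rightarrow> 'k poly poly poly" where
  "dehom = eval_mpoly (\<lambda>c. [:[:[:c:]:]:])
    (\<lambda>i. if i = 1 then monom [:[:0, 1:]:] 1 else if i = 2 then monom 1 1 else monom [:0, 1:] 1)"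

lemma is_ring_hom_const_poly3: "is_ring_hom (\<lambda>c :: 'k::field_char_0. [:[:[:c:]:]:])"
  by (simp add: is_ring_hom_def one_pCons)

lemma is_ring_hom_dehom: "is_ring_hom dehom"
  unfolding dehom_def by (intro is_ring_hom_eval_mpoly is_ring_hom_const_poly3)

lemma dehom_Const: "dehom (Const c) = [:[:[:c:]:]:]"
  and dehom_Var1: "dehom (Var 1) = monom [:[:0, 1:]:] 1"
  and dehom_Var2: "dehom (Var 2) = monom 1 1"
  and dehom_Var3: "dehom (Var 3) = monom [:0, 1:] 1"
  by (simp_all add: dehom_def eval_mpoly_Const eval_mpoly_Var is_ring_hom_const_poly3)

lemma dehom_single:
  "dehom (Poly_Mapping.single (mon a b c) e) = monom (monom (monom e a) c) (a + b + c)"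
proof -
  have x: "pCons 0 1 = monom 1 (Suc 0)" by (simp add: monom_Suc monom_0)
  have "Poly_Mapping.single (mon a b c) e = Const e * Var 1 ^ a * Var 2 ^ b * Var 3 ^ c"
    by (simp add: Var_power_single Const_def mult_single mon_def)
  also have "dehom \<dots> = monom (monom (monom e a) c) (a + b + c)"
    unfolding is_ring_hom_mult[OF is_ring_hom_dehom] is_ring_hom_power[OF is_ring_hom_dehom]
      dehom_Const dehom_Var1 dehom_Var2 dehom_Var3
    by (simp add: monom_power mult_monom x add_ac flip: monom_0)
  finally show ?thesis .
qed

text \<open>\<open>t\<close> is the total degree, \<open>c\<close> and \<open>a\<close> are the
  exponents of \<open>z\<close> and \<open>x\<close>, and \<open>y\<close> takes the rest; the guard
  rules out truncated subtraction.\<close>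

lemma coeff_dehom:
  "coeff (coeff (coeff (dehom p) t) c) a =
    (if a + c \<le> t then Poly_Mapping.lookup p (mon a (t - a - c) c) else 0)"
proof -
  let ?s = "\<lambda>m. Poly_Mapping.single m (Poly_Mapping.lookup p m)"
  have "dehom p = (\<Sum>m\<in>Poly_Mapping.keys p. dehom (?s m))"
    by (subst (1) poly_mapping_sum_singles[of p, symmetric]) (rule is_ring_hom_sum[OF is_ring_hom_dehom])
  then have "coeff (coeff (coeff (dehom p) t) c) a =
      (\<Sum>m\<in>Poly_Mapping.keys p. coeff (coeff (coeff (dehom (?s m)) t) c) a)"
    by (simp add: coeff_sum)
  also have "\<dots> = (\<Sum>m\<in>Poly_Mapping.keys p.
      if a + c \<le> t \<and> m = mon a (t - a - c) c then Poly_Mapping.lookup p m else 0)"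
  proof (rule sum.cong)
    fix m :: "3 monomial"
    define a' b' c' where "a' = Poly_Mapping.lookup m 1" and "b' = Poly_Mapping.lookup m 2"
      and "c' = Poly_Mapping.lookup m 3"
    have m: "m = mon a' b' c'" by (simp add: a'_def b'_def c'_def mon_lookup)
    show "coeff (coeff (coeff (dehom (?s m)) t) c) a =
        (if a + c \<le> t \<and> m = mon a (t - a - c) c then Poly_Mapping.lookup p m else 0)"
      unfolding m dehom_single by auto
  qed simp
  also have "\<dots> = (if a + c \<le> t then Poly_Mapping.lookup p (mon a (t - a - c) c) else 0)"
    by (auto simp: in_keys_iff)
  finally show ?thesis .
qed

text \<open>Multiplication by \<open>L^d\<close> becomes a shift of the degree by \<open>d\<close>
  and, within each degree, multiplication by \<open>(1 + x + z)^d\<close>.\<close>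

lemma dehom_linear_form_power_mult:
  "dehom ((Var 1 + Var 2 + Var 3) ^ d * B) = monom ([:[:1, 1:], 1:] ^ d) d * dehom B"
proof -
  have "dehom (Var 1 + Var 2 + Var 3 :: (3, 'a) mpoly) = monom [:[:1, 1:], 1:] 1"
    by (simp add: is_ring_hom_add[OF is_ring_hom_dehom] dehom_Var1 dehom_Var2 dehom_Var3 one_pCons
        add_monom)
  then show ?thesis
    by (simp add: is_ring_hom_mult[OF is_ring_hom_dehom] is_ring_hom_power[OF is_ring_hom_dehom]
        monom_power)
qed

section \<open>The initial ideals\<close>

definition ref_ideal :: "nat \<Rightarrow> (3, 'k::field_char_0) mpoly set" where
  "ref_ideal d = matrix_act reflect_shear ` I_ideal d"

lemma ref_ideal_conv:
  "ref_ideal d = ideal_gen ({Var 2 ^ a * Var 1 ^ (d - a) | a. a \<le> d - 1} \<union> {(Var 1 + Var 2 + Var 3) ^ d})"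
  by (simp only: ref_ideal_def reflect_shear_I_ideal)

lemma linear_form_power_in_ref_ideal: "(Var 1 + Var 2 + Var 3) ^ d * B \<in> ref_ideal d"
  unfolding ref_ideal_conv mult.commute[of _ B]
  by (intro ideal_gen_mult subsetD[OF ideal_gen_superset]) simp

text \<open>The monomials of the ideal \<open>x(x, y)\<^sup>d\<^sup>-\<^sup>1\<close>.\<close>

abbreviation in_monomial_part :: "nat \<Rightarrow> 3 monomial \<Rightarrow> bool" where
  "in_monomial_part d n \<equiv> 0 < Poly_Mapping.lookup n 1 \<and> d \<le> Poly_Mapping.lookup n 1 + Poly_Mapping.lookup n 2"

lemma single_in_ref_ideal:
  assumes "0 < d" "in_monomial_part d n"
  shows "Poly_Mapping.single n c \<in> ref_ideal d"
proof -
  define a b e where "a = Poly_Mapping.lookup n 1" and "b = Poly_Mapping.lookup n 2"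
    and "e = Poly_Mapping.lookup n 3"
  have n: "n = mon a b e" by (simp add: a_def b_def e_def mon_lookup)
  \<comment> \<open>Capping the exponent of \<open>x\<close> at \<open>d\<close> gives a generator
    \<open>x^i y^(d-i)\<close> that divides \<open>n\<close>.\<close>
  define i where "i = min a d"
  have i: "0 < i" "i \<le> a" "i \<le> d" "d - i \<le> b" "d - (d - i) = i"
    using assms by (auto simp: i_def a_def b_def)
  have "Poly_Mapping.single n c = Poly_Mapping.single (mon (a - i) (b - (d - i)) e) c *
      (Var 2 ^ (d - i) * Var 1 ^ (d - (d - i)))"
  proof -
    have "mon a b e = mon (a - i) (b - (d - i)) e + (Poly_Mapping.single 2 (d - i) + Poly_Mapping.single 1 (d - (d - i)))"
      unfolding monomial_eq_iff lookup_add lookup_mon lookup_single i(5) using i(2,4) by simp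
    then show ?thesis unfolding n Var_power_single mult_single by simp
  qed
  moreover have "Var 2 ^ (d - i) * Var 1 ^ (d - (d - i)) \<in>
      {Var 2 ^ a * Var 1 ^ (d - a) | a. a \<le> d - 1} \<union> {(Var 1 + Var 2 + Var 3) ^ d :: (3, 'a) mpoly}"
    using i by (intro UnI1 CollectI exI[of _ "d - i"]) auto
  ultimately show ?thesis
    unfolding ref_ideal_conv by (simp only: ideal_gen_mult subsetD[OF ideal_gen_superset])
qed

text \<open>Multiples of the monomial generators involve only the monomial part, so elsewhere the
  coefficients are those of a multiple of \<open>L^d\<close>.\<close>

lemma ref_ideal_decomposition:
  assumes "f \<in> ref_ideal d" "0 < d"
  obtains B where "\<And>n. \<not> in_monomial_part d n \<Longrightarrow>
    Poly_Mapping.lookup f n = Poly_Mapping.lookup ((Var 1 + Var 2 + Var 3) ^ d * B) n"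
proof -
  let ?L = "(Var 1 + Var 2 + Var 3) ^ d"
  have "\<exists>B. \<forall>n. \<not> in_monomial_part d n \<longrightarrow> Poly_Mapping.lookup f n = Poly_Mapping.lookup (?L * B) n"
    using assms(1) unfolding ref_ideal_conv
  proof (induction rule: ideal_gen_induct)
    case base
    show ?case by (intro exI[of _ 0]) simp
  next
    case (step c b q)
    then obtain B where B: "\<And>n. \<not> in_monomial_part d n \<Longrightarrow> Poly_Mapping.lookup q n = Poly_Mapping.lookup (?L * B) n"
      by blast
    from step.hyps consider a where "a \<le> d - 1" "b = Var 2 ^ a * Var 1 ^ (d - a)" | "b = ?L"
      unfolding Un_iff mem_Collect_eq by (elim disjE exE conjE) simp_all
    from this show ?case
    proof cases
      case 1
      have "Poly_Mapping.lookup (c * b) n = 0" if "\<not> in_monomial_part d n" for n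
      proof (rule ccontr)
        assume "Poly_Mapping.lookup (c * b) n \<noteq> 0"
        then have "n \<in> Poly_Mapping.keys (c * b)" by (simp add: in_keys_iff)
        then obtain k where "n = k + (Poly_Mapping.single 2 a + Poly_Mapping.single 1 (d - a))"
          using keys_mult[of c b] unfolding 1 Var_power_single mult_single by (auto split: if_splits)
        then have "in_monomial_part d n"
          using 1(1) assms(2) by (auto simp: lookup_add lookup_single)
        with that show False by simp
      qed
      then show ?thesis using B by (intro exI[of _ B]) (simp add: lookup_add)
    next
      case 2
      have "?L * (c + B) = c * b + ?L * B" by (simp only: 2 distrib_left mult.commute[of c])
      then show ?thesis using B by (intro exI[of _ "c + B"]) (simp add: lookup_add)
    qed
  qed
  then show ?thesis using that by blast
qed

text \<open>The absence of monomials above \<open>y^d z^k\<close> supplies the column conditions of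
  \<open>row_not_small\<close>; the nonzero entry which that produces belongs to a larger monomial,
  a contradiction.\<close>

lemma lead_in_ref_ideal_lower_bound:
  fixes f :: "(3, 'k::field_char_0) mpoly"
  assumes f: "f \<in> ref_ideal d" and lead: "has_lead (grid_order m) (mon 0 d k) e f" "e \<noteq> 0" and "0 < m"
  shows "d \<le> k + m + 1"
proof (rule ccontr)
  assume less: "\<not> d \<le> k + m + 1"
  obtain B where B: "\<And>n. \<not> in_monomial_part d n \<Longrightarrow>
      Poly_Mapping.lookup f n = Poly_Mapping.lookup ((Var 1 + Var 2 + Var 3) ^ d * B) n"
    using ref_ideal_decomposition[OF f] less by (metis not_gr_zero zero_le)
  \<comment> \<open>The part of degree \<open>d + k\<close> of the multiple of \<open>L^d\<close>,
    which comes from the part of degree \<open>k\<close> of \<open>B\<close>.\<close>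
  define g where "g = [:[:1, 1:], 1:] ^ d * coeff (dehom B) k"
  have g: "coeff (coeff g c) a = (if a + c \<le> d + k
      then Poly_Mapping.lookup ((Var 1 + Var 2 + Var 3) ^ d * B) (mon a (d + k - a - c) c) else 0)" for a c
    using coeff_dehom[of "(Var 1 + Var 2 + Var 3) ^ d * B" "d + k" c a]
    by (simp add: g_def dehom_linear_form_power_mult coeff_monom_mult)
  have above: "Poly_Mapping.lookup f n = 0" if "(mon 0 d k, n) \<in> grid_order m" for n
  proof (rule ccontr)
    assume "Poly_Mapping.lookup f n \<noteq> 0"
    then have "n = mon 0 d k \<or> (n, mon 0 d k) \<in> grid_order m"
      using lead(1) by (simp add: has_lead_def in_keys_iff)
    then show False
      using that term_order_trans[OF term_order_grid_order[OF \<open>0 < m\<close>], of n "mon 0 d k" n]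
        term_order_irrefl[OF term_order_grid_order[OF \<open>0 < m\<close>], of n] by auto
  qed
  have "\<exists>a>m. coeff (coeff g (k + 1)) a \<noteq> 0"
    unfolding g_def
  proof (rule row_not_small, fold g_def)
    show "k + m + 1 < d" using less by simp
    show "coeff (coeff (dehom B) k) i = 0" if "k < i" for i
      using that by (intro poly_eqI) (simp add: coeff_dehom)
    show "coeff (coeff g c) 0 = 0" if "c < k" for c
    proof -
      have "coeff (coeff g c) 0 = Poly_Mapping.lookup f (mon 0 (d + k - c) c)"
        using that by (simp add: g B)
      also have "\<dots> = 0"
      proof (rule above)
        have "d < d + k - c" using that by linarith
        then show "(mon 0 d k, mon 0 (d + k - c) c) \<in> grid_order m"
          using \<open>0 < m\<close> by (simp only: mon_in_grid_order) simp
      qed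
      finally show ?thesis .
    qed
    have "coeff (coeff g k) 0 = Poly_Mapping.lookup f (mon 0 d k)" by (simp add: g B)
    then show "coeff (coeff g k) 0 \<noteq> 0" using lead by (simp add: has_lead_def)
  qed
  then obtain a where a: "m < a" "coeff (coeff g (k + 1)) a \<noteq> 0" by blast
  then have "a + (k + 1) \<le> d + k" by (simp add: g split: if_splits)
  then have ad: "a \<le> d - 1" "0 < d" by auto
  \<comment> \<open>The monomial \<open>x^a y^(d-1-a) z^(k+1)\<close> has degree
    \<open>d - 1\<close> in \<open>x\<close> and \<open>y\<close>, so it avoids the monomial part;
    its weight exceeds that of \<open>y^d z^k\<close> by \<open>a - m\<close>.\<close>
  then have out: "\<not> in_monomial_part d (mon a (d - 1 - a) (k + 1))"
    and "a + (k + 1) \<le> d + k" "d + k - a - (k + 1) = d - 1 - a"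
    by auto
  then have "coeff (coeff g (k + 1)) a = Poly_Mapping.lookup f (mon a (d - 1 - a) (k + 1))"
    by (simp only: g B[OF out] if_True)
  also have "\<dots> = 0"
  proof (rule above)
    define b where "b = d - 1 - a"
    have "d = a + b + 1" using ad by (simp add: b_def)
    then have "m * d = m * a + m * b + m" by (simp add: distrib_left)
    then show "(mon 0 d k, mon a (d - 1 - a) (k + 1)) \<in> grid_order m"
      using a(1) unfolding mon_in_grid_order b_def[symmetric] by simp
  qed
  finally show False using a(2) by simp
qed

lemma lead_in_ref_ideal_exists:
  assumes k: "0 < k" "2 * k \<le> d" "3 \<le> d"
  obtains f :: "(3, 'k::field_char_0) mpoly"
  where "f \<in> ref_ideal d" "has_lead (grid_order (d - 1 - k)) (mon 0 d k) 1 f"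
proof -
  define m where "m = d - 1 - k"
  \<comment> \<open>The hypothesis \<open>2 * k \<le> d\<close> enters as
    \<open>d \<le> 2 * m + 2\<close>, which controls the rows beyond \<open>k + 1\<close>.\<close>
  have m: "0 < m" "d = m + k + 1" "d \<le> 2 * m + 2" using k by (auto simp: m_def)
  define \<kappa> where "\<kappa> = (of_nat d / of_nat (d choose (k + 1)) :: 'k)"
  define B :: "(3, 'k) mpoly" where "B = Var 3 ^ k + Const \<kappa> * (Var 2 ^ k - (Var 1 + Var 2) ^ k)"
  define f0 where "f0 = (Var 1 + Var 2 + Var 3) ^ d * B"
  have "dehom (Var 1 + Var 2 :: (3, 'k) mpoly) = monom [:[:1, 1:]:] 1"
    by (simp add: is_ring_hom_add[OF is_ring_hom_dehom] dehom_Var1 dehom_Var2 one_pCons add_monom)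
  then have "dehom B = monom ([:0, 1:] ^ k) k + [:[:[:\<kappa>:]:]:] * (monom 1 k - monom ([:[:1, 1:]:] ^ k) k)"
    by (simp add: B_def is_ring_hom_add[OF is_ring_hom_dehom] is_ring_hom_mult[OF is_ring_hom_dehom]
        is_ring_hom_power[OF is_ring_hom_dehom] is_ring_hom_diff[OF is_ring_hom_dehom]
        dehom_Var2 dehom_Var3 dehom_Const monom_power)
  also have "\<dots> = monom (witness_row d k) k"
  proof -
    have "[:0, 1:] ^ k = (monom 1 k :: 'k poly poly)"
      by (simp add: monom_altdef)
    moreover have "[:[:1, 1:]:] ^ k = ([:[:1, 1:] ^ k:] :: 'k poly poly)"
      by (simp add: poly_const_pow)
    ultimately show ?thesis
      by (simp add: witness_row_def \<kappa>_def smult_monom add_monom diff_monom one_pCons)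
  qed
  finally have dB: "dehom B = monom (witness_row d k) k" .
  define g :: "'k poly poly" where "g = [:[:1, 1:], 1:] ^ d * witness_row d k"
  have f0: "coeff (dehom f0) t = (if t = d + k then g else 0)" for t
    by (simp add: f0_def dehom_linear_form_power_mult dB g_def mult_monom)
  have lookup_f0: "Poly_Mapping.lookup f0 (mon a b c) = (if a + b + c = d + k then coeff (coeff g c) a else 0)" for a b c
    using coeff_dehom[of f0 "a + b + c" c a] by (simp add: f0 split: if_splits)
  \<comment> \<open>Dropping the terms of \<open>f0\<close> in the monomial part stays inside the
    ideal and removes the large monomials divisible by \<open>x\<close>.\<close>
  define f where "f = (\<Sum>n\<in>{n \<in> Poly_Mapping.keys f0. \<not> in_monomial_part d n}. Poly_Mapping.single n (Poly_Mapping.lookup f0 n))"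
  have "f0 = f + (\<Sum>n\<in>{n \<in> Poly_Mapping.keys f0. in_monomial_part d n}. Poly_Mapping.single n (Poly_Mapping.lookup f0 n))"
    unfolding f_def by (subst (1) poly_mapping_sum_singles[of f0, symmetric], subst sum.union_disjoint[symmetric])
      (auto intro!: sum.cong)
  moreover have "(\<Sum>n\<in>{n \<in> Poly_Mapping.keys f0. in_monomial_part d n}. Poly_Mapping.single n (Poly_Mapping.lookup f0 n)) \<in> ref_ideal d"
    unfolding ref_ideal_conv
    by (intro ideal_gen_sum, fold ref_ideal_conv) (use k in \<open>auto intro!: single_in_ref_ideal\<close>)
  ultimately have "f \<in> ref_ideal d"
    using linear_form_power_in_ref_ideal[of d B] unfolding f0_def[symmetric]
    by (metis (no_types, lifting) add_diff_cancel_right' ideal_gen_diff ref_ideal_conv)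
  have lookup_f: "Poly_Mapping.lookup f n = (if in_monomial_part d n then 0 else Poly_Mapping.lookup f0 n)" for n
    by (auto simp: f_def lookup_sum lookup_single when_def in_keys_iff)
  have "k < d" using k by simp
  note rows = witness_row_products[OF k(1) this, where 'k = 'k, folded g_def m_def]
  have "has_lead (grid_order m) (mon 0 d k) 1 f"
    unfolding has_lead_def
  proof (intro conjI ballI)
    show "Poly_Mapping.lookup f (mon 0 d k) = 1" by (simp add: lookup_f lookup_f0 rows)
    fix n assume "n \<in> Poly_Mapping.keys f"
    define a b c where "a = Poly_Mapping.lookup n 1" and "b = Poly_Mapping.lookup n 2"
      and "c = Poly_Mapping.lookup n 3"
    have n: "n = mon a b c" by (simp add: a_def b_def c_def mon_lookup)
    have "Poly_Mapping.lookup f (mon a b c) \<noteq> 0" using \<open>n \<in> _\<close> by (simp add: n in_keys_iff)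
    then have nin: "a = 0 \<or> a + b < d" and deg: "a + b + c = d + k" and g: "coeff (coeff g c) a \<noteq> 0"
      by (auto simp: lookup_f lookup_f0 split: if_splits)
    show "n = mon 0 d k \<or> (n, mon 0 d k) \<in> grid_order m"
    proof (cases "a = 0")
      case True
      have "k \<le> c" using g rows(1)[of c] True by (cases "k \<le> c") auto
      then show ?thesis
        using True deg m(1) by (cases "c = k") (auto simp: n mon_in_grid_order)
    next
      case False
      define j where "j = c - k"
      have j: "c = k + j" "0 < j" "a + b + j = d" using nin False deg by (auto simp: j_def)
      \<comment> \<open>Row \<open>k + 1\<close> is bounded by the choice of the witness. For
        \<open>j \<ge> 2\<close> the degree suffices:
        \<open>a \<le> d - j \<le> 2 * m + 2 - j\<close>.\<close>
      have "a \<le> m * j"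
      proof (cases "j = 1")
        case True
        then show ?thesis using g rows(2)[of a] j by (cases "m < a") auto
      next
        case False
        then have "2 \<le> j" using j by simp
        then obtain i where i: "j = i + 2" using le_Suc_ex by (metis add.commute)
        have "i \<le> m * i" using m(1) by simp
        then show ?thesis using m(3) j unfolding i by simp
      qed
      moreover have "m * d = m * a + m * b + m * j" by (simp flip: j(3) add: distrib_left)
      moreover have "b < d" using j False by simp
      \<comment> \<open>The weights may be equal; then the smaller exponent of \<open>y\<close>
        decides.\<close>
      ultimately have "(m + 1) * a + m * b \<le> (m + 1) * 0 + m * d" by simp
      then show ?thesis using \<open>b < d\<close> unfolding n mon_in_grid_order by linarith
    qed
  qed
  then show ?thesis using that \<open>f \<in> ref_ideal d\<close> by (simp add: m_def)
qed

section \<open>Counting distinct generic initial ideals\<close>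

theorem theorem2p12:
  fixes d :: nat
  assumes "3 \<le> d"
  shows "\<exists>G \<subseteq> generic_initial_ideals (I_ideal d :: (3, 'k::field_char_0) mpoly set).
    finite G \<and> real d / 3 \<le> real (card G)"
proof -
  define J :: "nat \<Rightarrow> (3, 'k) mpoly set" where "J k = initial_ideal (grid_order (d - 1 - k)) (ref_ideal d)" for k
  let ?K = "{1..d div 2}"
  have pos: "0 < d - 1 - k" if "k \<in> ?K" for k using that assms by auto
  have "J k \<in> generic_initial_ideals (I_ideal d)" if "k \<in> ?K" for k
    unfolding J_def ref_ideal_def generic_initial_ideals_def
    using term_order_grid_order[OF pos[OF that]]
      is_gin_I_ideal[OF term_order_grid_order[OF pos[OF that]] variables_in_grid_order[OF pos[OF that]]]
    by blast
  moreover have "J k \<noteq> J l" if kl: "k \<in> ?K" "l \<in> ?K" "k < l" for k l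
  proof
    assume eq: "J k = J l"
    have "0 < k" "2 * k \<le> d" using kl(1) by auto
    then obtain f :: "(3, 'k) mpoly" where f: "f \<in> ref_ideal d" "has_lead (grid_order (d - 1 - k)) (mon 0 d k) 1 f"
      using lead_in_ref_ideal_exists assms by blast
    have "Poly_Mapping.single (mon 0 d k) 1 \<in> J k"
      unfolding J_def by (rule monomial_in_initial_idealI[OF term_order_grid_order[OF pos[OF kl(1)]] f(1) _ f(2)]) simp
    then have "Poly_Mapping.single (mon 0 d k) 1 \<in> J l" unfolding eq .
    then obtain p :: "(3, 'k) mpoly" and c
      where p: "p \<in> ref_ideal d" "c \<noteq> 0" "has_lead (grid_order (d - 1 - l)) (mon 0 d k) c p"
      unfolding J_def ref_ideal_conv
      by (elim monomial_in_initial_idealD[OF term_order_grid_order[OF pos[OF kl(2)]]]) blast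
    \<comment> \<open>For the order belonging to \<open>l\<close> the bound reads
      \<open>l \<le> k\<close>, whereas \<open>k < l\<close>.\<close>
    have "d \<le> k + (d - 1 - l) + 1"
      using lead_in_ref_ideal_lower_bound[OF p(1,3,2) pos[OF kl(2)]] .
    then show False using kl by auto
  qed
  then have "inj_on J ?K" by (intro inj_onI) (metis nat_neq_iff)
  then have "card (J ` ?K) = d div 2" by (simp add: card_image)
  \<comment> \<open>Here \<open>2 * (d div 2) \<ge> d - 1\<close>, and
    \<open>d div 2 \<ge> 1\<close> because \<open>d \<ge> 3\<close>.\<close>
  moreover have "d \<le> 3 * (d div 2)" using assms by linarith
  then have "real d / 3 \<le> real (d div 2)" by linarith
  ultimately show ?thesis by (intro exI[of _ "J ` ?K"]) auto
qed

end
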